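(* Let $q\ge0$ be an integer, let $V$ be an open set in $\mathbb{R}^n$ and let $\Omega_V:=\{z\in\mathbb{C}^n:(\ln|z_1|,\dots,\ln|z_n|)\in V\}$. Let $u:V\to[-\infty,+\infty)$ be a function. Then $u$ is real $q$-convex on $V$ if and only if the function $\psi:z\mapsto u(\ln|z_1|,\dots,\ln|z_n|)$ is $q$-plurisubharmonic on $\Omega_V$.
   Context: Points of $\Omega_V$ have all coordinates nonzero. Real $q$-convex functions: let $\omega\subset\mathbb{R}^n$ be open and $q\in\{0,\dots,n-1\}$. An upper semi-continuous function $u:\omega\to[-\infty,+\infty)$ is real $q$-convex on $\omega$ if for every real $(q+1)$-dimensional affine subspace $\pi$ of $\mathbb{R}^n$, every open Euclidean ball $B$ relatively compact in $\omega$ and every affine linear function $l:\pi\to\mathbb{R}$ with $u\le l$ on $\partial B\cap\pi$, one has $u\le l$ on $\overline{B}\cap\pi$. If $q\ge n$, every upper semi-continuous function on $\omega$ is real $q$-convex by convention. $q$-plurisubharmonic functions: let $\Omega\subset\mathbb{C}^n$ be open and $q\in\{0,\dots,n-1\}$. An upper semi-continuous function $\psi:\Omega\to[-\infty,+\infty)$ is $q$-plurisubharmonic on $\Omega$ if for every complex $(q+1)$-dimensional affine subspace $\Pi$ of $\mathbb{C}^n$, every open Euclidean ball $B$ relatively compact in $\Omega$ and every pluriharmonic function $h$ defined in a neighborhood of $\overline{B}$ with $\psi\le h$ on $\partial B\cap\Pi$, one has $\psi\le h$ on $\overline{B}\cap\Pi$. If $q\ge n$, every upper semi-continuous function on $\Omega$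 is $q$-plurisubharmonic by convention. *)

theory Defs
  imports "HOL-Analysis.Analysis"
begin

text \<open>Functions into \<open>[-\<infinity>, +\<infinity>)\<close> on a set \<open>S\<close> are total functions into \<^typ>\<open>ereal\<close>; the values
  outside \<open>S\<close> play no role.\<close>

definition usc_on :: "'a::topological_space set \<Rightarrow> ('a \<Rightarrow> ereal) \<Rightarrow> bool" where
  "usc_on S u \<longleftrightarrow> (\<forall>x\<in>S. u x \<noteq> \<infinity>) \<and> (\<forall>c. openin (top_of_set S) {x \<in> S. u x < c})"

definition affine_fun_on :: "'a::real_vector set \<Rightarrow> ('a \<Rightarrow> real) \<Rightarrow> bool" where
  "affine_fun_on S l \<longleftrightarrow>
     (\<forall>x\<in>S. \<forall>y\<in>S. \<forall>s t. s + t = 1 \<longrightarrow> l (s *\<^sub>R x + t *\<^sub>R y) = s * l x + t * l y)"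

text \<open>The sets \<open>W\<close>, \<open>S\<close>, \<open>U\<close> below are meant to be open. An open ball is nonempty, hence \<open>r > 0\<close>, and it is
  relatively compact in \<open>W\<close> iff its closure \<open>cball c r\<close> is contained in \<open>W\<close>.\<close>

definition real_q_convex_on :: "nat \<Rightarrow> (real ^ 'n) set \<Rightarrow> (real ^ 'n \<Rightarrow> ereal) \<Rightarrow> bool" where
  "real_q_convex_on q W u \<longleftrightarrow> usc_on W u \<and>
     (q < CARD('n) \<longrightarrow>
       (\<forall>P c r l. affine P \<and> aff_dim P = int (q + 1) \<and> r > 0 \<and> cball c r \<subseteq> W \<and> affine_fun_on P l \<and>
          (\<forall>x \<in> sphere c r \<inter> P. u x \<le> ereal (l x))
          \<longrightarrow> (\<forall>x \<in> cball c r \<inter> P. u x \<le> ereal (l x))))"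

definition C2_on_with ::
  "'a::euclidean_space set \<Rightarrow> ('a \<Rightarrow> real) \<Rightarrow> ('a \<Rightarrow> 'a \<Rightarrow>\<^sub>L real) \<Rightarrow> ('a \<Rightarrow> 'a \<Rightarrow>\<^sub>L 'a \<Rightarrow>\<^sub>L real) \<Rightarrow> bool" where
  "C2_on_with S f f' f'' \<longleftrightarrow>
     (\<forall>x\<in>S. (f has_derivative blinfun_apply (f' x)) (at x)) \<and>
     (\<forall>x\<in>S. (f' has_derivative blinfun_apply (f'' x)) (at x)) \<and>
     continuous_on S f''"

definition harmonic_on :: "'a::euclidean_space set \<Rightarrow> ('a \<Rightarrow> real) \<Rightarrow> bool" where
  "harmonic_on S f \<longleftrightarrow>
     (\<exists>f' f''. C2_on_with S f f' f'' \<and>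
        (\<forall>x\<in>S. (\<Sum>b\<in>Basis. blinfun_apply (blinfun_apply (f'' x) b) b) = 0))"

text \<open>Pluriharmonic: of class \<open>C\<^sup>2\<close> and harmonic along every complex line.\<close>

definition pluriharmonic_on :: "(complex ^ 'n) set \<Rightarrow> (complex ^ 'n \<Rightarrow> real) \<Rightarrow> bool" where
  "pluriharmonic_on U h \<longleftrightarrow> (\<exists>h' h''. C2_on_with U h h' h'') \<and>
     (\<forall>a b. harmonic_on {\<zeta>. a + \<zeta> *s b \<in> U} (\<lambda>\<zeta>. h (a + \<zeta> *s b)))"

text \<open>The constants \<open>vec.subspace\<close> and \<open>vec.dim\<close> are taken over the complex field here.\<close>

definition complex_affine_subspace :: "nat \<Rightarrow> (complex ^ 'n) set \<Rightarrow> bool" where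
  "complex_affine_subspace k P \<longleftrightarrow>
     (\<exists>a L. vec.subspace L \<and> vec.dim L = k \<and> P = (+) a ` L)"

definition q_plurisubharmonic_on :: "nat \<Rightarrow> (complex ^ 'n) set \<Rightarrow> (complex ^ 'n \<Rightarrow> ereal) \<Rightarrow> bool" where
  "q_plurisubharmonic_on q W \<psi> \<longleftrightarrow> usc_on W \<psi> \<and>
     (q < CARD('n) \<longrightarrow>
       (\<forall>P c r U h. complex_affine_subspace (q + 1) P \<and> r > 0 \<and> cball c r \<subseteq> W \<and>
          open U \<and> cball c r \<subseteq> U \<and> pluriharmonic_on U h \<and>
          (\<forall>z \<in> sphere c r \<inter> P. \<psi> z \<le> ereal (h z))
          \<longrightarrow> (\<forall>z \<in> cball c r \<inter> P. \<psi> z \<le> ereal (h z))))"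

definition ln_abs :: "complex ^ 'n \<Rightarrow> real ^ 'n" where
  "ln_abs z = (\<chi> i. ln (cmod (z $ i)))"

text \<open>Since \<open>ln 0 = 0\<close> in HOL, nonvanishing of the coordinates has to be required explicitly.\<close>

definition Omega :: "(real ^ 'n) set \<Rightarrow> (complex ^ 'n) set" where
  "Omega V = {z. (\<forall>i. z $ i \<noteq> 0) \<and> ln_abs z \<in> V}"

end

(*
  A function violates real q-convexity or q-plurisubharmonicity on a ball and a subspace P iff, after adding
  a small multiple of -|x - c|^2 and a large multiple of dist(x, P)^2 to the affine or pluriharmonic majorant, it is
  touched from above at an interior point by a C^2 function whose Hessian (Levi form) is negative
  definite along P. Such touching functions can be transported through the logarithm.

  From the real to the complex side, the Levi form of phi(ln|z_1|, ..., ln|z_n|) is the Hermitian extension of the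
  Hessian of phi. Conversely, let a function Phi on the tube touch u(Re v) from above, with Levi form negative definite on
  a complex subspace of dimension q + 1. The Hessian of Phi is negative definite on a real
  subspace N of dimension q + 1, and it is nonnegative on imaginary vectors. So Re is injective on N, and Re N is
  a direction in which u violates real q-convexity.
*)
theory Submission
  imports Defs
begin

section \<open>Upper semicontinuity and penalization\<close>

text \<open>The logarithm preserves neither balls nor affine subspaces, so a violation cannot be
  carried over as it stands. Only second-order data at one point survive: a subspace is remembered
  through its directions, and the ball is replaced by a small one. This is why the competitor must
  dominate the function on a full neighbourhood and not only on the slice \<open>P\<close>: the
  image of the slice is curved, and the multiple of the squared distance to \<open>P\<close>
  controls the function off it. The multiple of |x - c|^2 gives a margin of strict negativity that
  pays for all third-order errors, so transported functions are never differentiated; they are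
  compared with quadratic polynomials read off from ln(1 + w) = w - w^2/2 + ... and exp v = 1 + v +
  v^2/2 + .... The terms w^2 and v^2 change sign when the vector is multiplied by \<i>, so they
  never reach the Levi form. In passing to the real side, a complex subspace with 2(q + 1) real
  dimensions has to yield just q + 1 negative ones, and this surplus is what the construction of N
  spends.\<close>

lemma usc_on_subset:
  assumes "usc_on S f" "T \<subseteq> S"
  shows "usc_on T f"
proof -
  have "openin (top_of_set T) {x \<in> T. f x < c}" for c
  proof -
    from assms(1) obtain O' where "open O'" "{x \<in> S. f x < c} = S \<inter> O'"
      unfolding usc_on_def openin_open by blast
    then have "{x \<in> T. f x < c} = T \<inter> O'" using assms(2) by blast
    with \<open>open O'\<close> show ?thesis unfolding openin_open by blast
  qed
  then show ?thesis using assms unfolding usc_on_def by blast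
qed

lemma usc_on_compose:
  assumes "usc_on T f" "continuous_on S g" "g ` S \<subseteq> T"
  shows "usc_on S (\<lambda>x. f (g x))"
proof -
  have "openin (top_of_set S) {x \<in> S. f (g x) < c}" for c
  proof -
    have "{x \<in> S. f (g x) < c} = S \<inter> g -` {y \<in> T. f y < c}"
      using assms(3) by auto
    moreover have "openin (top_of_set S) (S \<inter> g -` {y \<in> T. f y < c})"
      by (rule continuous_openin_preimage[where T = T])
        (use assms in \<open>auto simp: usc_on_def\<close>)
    ultimately show ?thesis by simp
  qed
  then show ?thesis using assms unfolding usc_on_def by blast
qed

lemma usc_on_minus_continuous:
  fixes f :: "'a::topological_space \<Rightarrow> ereal"
  assumes f: "usc_on S f" and k: "continuous_on S k"
  shows "usc_on S (\<lambda>x. f x - ereal (k x))"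
  unfolding usc_on_def
proof (intro conjI ballI allI)
  fix x assume "x \<in> S"
  then show "f x - ereal (k x) \<noteq> \<infinity>"
    using f unfolding usc_on_def by (cases "f x") auto
next
  fix c
  show "openin (top_of_set S) {x \<in> S. f x - ereal (k x) < c}" (is "openin _ ?A")
  proof (subst openin_subopen, intro ballI)
    fix x assume "x \<in> ?A"
    then have xS: "x \<in> S" and less: "f x - ereal (k x) < c" by auto
    have "f x < c + ereal (k x)" using less by (cases "f x"; cases c) auto
    then obtain s where s: "f x < ereal s" "ereal s < c + ereal (k x)"
      using ereal_dense2 by blast
    \<comment> \<open>The numbers \<open>s\<close> and \<open>t\<close> decouple the inequality:
      \<open>f y < s\<close> and \<open>k y > t\<close> are separate open conditions, and together
      they give \<open>f y - k y < c\<close>, also for infinite \<open>c\<close>.\<close>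
    have "\<exists>t. t < k x \<and> ereal s \<le> c + ereal t"
    proof (cases c)
      case (real c')
      then show ?thesis using s(2) by (intro exI[of _ "s - c'"]) auto
    next
      case PInf
      then show ?thesis by (intro exI[of _ "k x - 1"]) auto
    next
      case MInf
      then show ?thesis using s(2) by simp
    qed
    then obtain t where t: "t < k x" "ereal s \<le> c + ereal t" by blast
    let ?T = "{y \<in> S. f y < ereal s} \<inter> (S \<inter> k -` {t<..})"
    have "openin (top_of_set S) {y \<in> S. f y < ereal s}" using f unfolding usc_on_def by blast
    then have "openin (top_of_set S) ?T"
      using continuous_openin_preimage_gen[OF k open_greaterThan] by (rule openin_Int)
    moreover have "x \<in> ?T" using xS s t by auto
    moreover have "?T \<subseteq> ?A"
    proof
      fix y assume y: "y \<in> ?T"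
      have "f y < c + ereal t" using y t(2) by auto
      with y show "y \<in> ?A" by (cases "f y"; cases c) auto
    qed
    ultimately show "\<exists>T. openin (top_of_set S) T \<and> x \<in> T \<and> T \<subseteq> ?A" by blast
  qed
qed

text \<open>Otherwise the sets \<open>{f < f y}\<close> with \<open>y\<close> in \<open>K\<close>
  would cover \<open>K\<close>; in a finite subcover, the index with the largest value of
  \<open>f\<close> lies in none of the sets.\<close>

lemma usc_on_compact_attains_sup:
  fixes f :: "'a::topological_space \<Rightarrow> ereal"
  assumes f: "usc_on K f" and K: "compact K" "K \<noteq> {}"
  obtains x where "x \<in> K" "\<And>y. y \<in> K \<Longrightarrow> f y \<le> f x"
proof (rule ccontr)
  note that_max = that
  assume contr: "\<not> thesis"
  then have no_max: "\<exists>y\<in>K. f x < f y" if "x \<in> K" for x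
    using contr that_max that by (meson not_le_imp_less)
  have "\<exists>O'. open O' \<and> {x \<in> K. f x < c} = K \<inter> O'" for c
    using f unfolding usc_on_def openin_open by blast
  then obtain G where G: "\<And>c. open (G c)" "\<And>c. {x \<in> K. f x < c} = K \<inter> G c"
    by metis
  have "K \<subseteq> (\<Union>y\<in>K. G (f y))"
    using no_max G(2) by blast
  then obtain D where D: "D \<subseteq> K" "finite D" "K \<subseteq> (\<Union>y\<in>D. G (f y))"
    using compactE_image[OF K(1), of K "\<lambda>y. G (f y)"] G(1) by metis
  have "D \<noteq> {}" using D(3) K(2) by auto
  then have "Max (f ` D) \<in> f ` D" using D(2) by (intro Max_in) auto
  then obtain m where m: "m \<in> D" "f m = Max (f ` D)" by auto
  obtain y where "y \<in> D" "m \<in> G (f y)" using D m(1) by blast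
  then have "f m < f y" using G(2)[of "f y"] D(1) m(1) by blast
  moreover have "f y \<le> f m" using m(2) D(2) \<open>y \<in> D\<close> by simp
  ultimately show False by simp
qed

text \<open>In the applications \<open>g\<close> is the squared distance to the subspace
  \<open>P\<close>, and \<open>\<phi>\<close> is the majorant on the whole ball. The difference of
  \<open>f\<close> and \<open>\<phi>\<close> is positive at \<open>y\<close> but not on the slice of
  the sphere, so its penalized version has its maximum in the open ball; there a shift of the
  penalized majorant touches \<open>f\<close> from above.\<close>

lemma penalized_max:
  fixes f :: "'a::euclidean_space \<Rightarrow> ereal"
  assumes f: "usc_on (cball c r) f"
    and \<phi>: "continuous_on (cball c r) \<phi>" and g: "continuous_on (cball c r) g"
    and g_nonneg: "\<And>x. g x \<ge> (0::real)" and r: "r > 0"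
    and bdry: "\<And>x. x \<in> sphere c r \<Longrightarrow> g x = 0 \<Longrightarrow> f x \<le> ereal (\<phi> x)"
    and y: "y \<in> cball c r" "g y = 0" "\<not> f y \<le> ereal (\<phi> y)"
  obtains \<epsilon> M x0 \<alpha> where "\<epsilon> > 0" "x0 \<in> ball c r" "f x0 = ereal \<alpha>"
    "\<And>x. x \<in> cball c r \<Longrightarrow> f x \<le> ereal (\<alpha> + (\<phi> x - \<epsilon> * (norm (x - c))\<^sup>2 + M * g x)
         - (\<phi> x0 - \<epsilon> * (norm (x0 - c))\<^sup>2 + M * g x0))"
proof -
  from y(3) have "ereal (\<phi> y) < f y" by simp
  then have "0 < f y - ereal (\<phi> y)" by (cases "f y") auto
  then obtain \<delta> where \<delta>: "ereal \<delta> < f y - ereal (\<phi> y)" "\<delta> > 0"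
    using ereal_dense2[of 0 "f y - ereal (\<phi> y)"] by auto
  \<comment> \<open>The term \<epsilon> |x - c|^2 adds only \<delta>/2 on the sphere, less than the
    excess at \<open>y\<close>.\<close>
  define \<epsilon> where "\<epsilon> = \<delta> / (2 * r\<^sup>2)"
  have eps: "\<epsilon> > 0" "\<epsilon> * r\<^sup>2 < \<delta>" using \<delta>(2) r by (auto simp: \<epsilon>_def)
  define k where "k x = \<phi> x - \<epsilon> * (norm (x - c))\<^sup>2" for x
  have k: "continuous_on (cball c r) k"
    unfolding k_def by (intro continuous_intros \<phi>)
  define F where "F x = f x - ereal (k x)" for x
  have F: "usc_on (cball c r) F"
    unfolding F_def by (rule usc_on_minus_continuous[OF f k])
  have Fy: "F y > ereal \<delta>"
  proof -
    have "f y - ereal (\<phi> y) \<le> F y"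
      unfolding F_def k_def using eps(1) by (cases "f y") auto
    then show ?thesis using \<delta>(1) by simp
  qed
  have nonempty: "cball c r \<noteq> {}" using r by simp
  obtain m where m: "m \<in> cball c r" "\<And>x. x \<in> cball c r \<Longrightarrow> F x \<le> F m"
    using usc_on_compact_attains_sup[OF F compact_cball nonempty] by blast
  have "F m \<noteq> \<infinity>" using F m(1) unfolding usc_on_def by blast
  moreover have "F m \<noteq> -\<infinity>" using m(2)[OF y(1)] Fy by auto
  ultimately obtain C where C: "F m = ereal C" by (cases "F m") auto
  \<comment> \<open>Only these boundary points could compete with \<open>y\<close>. They lie off the
    slice, so compactness bounds \<open>g\<close> away from 0 on them.\<close>
  define S where "S = {x \<in> sphere c r. F x \<ge> ereal \<delta>}"
  have "S = sphere c r - {x \<in> sphere c r. F x < ereal \<delta>}"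
    unfolding S_def by auto
  moreover have "usc_on (sphere c r) F" using F by (rule usc_on_subset) auto
  ultimately have "closedin (top_of_set (sphere c r)) S"
    unfolding usc_on_def by (metis closedin_diff closedin_subtopology_refl topspace_euclidean_subtopology closedin_topspace)
  then have S: "compact S" by (rule closedin_compact[OF compact_sphere])
  have gS: "g x > 0" if "x \<in> S" for x
  proof (rule ccontr)
    assume "\<not> g x > 0"
    then have "g x = 0" using g_nonneg[of x] by simp
    then have "f x \<le> ereal (\<phi> x)" using bdry that unfolding S_def by simp
    moreover have "norm (x - c) = r" using that unfolding S_def by (simp add: dist_norm norm_minus_commute)
    ultimately have "F x \<le> ereal (\<epsilon> * r\<^sup>2)"
      unfolding F_def k_def by (cases "f x") auto
    moreover have "F x \<ge> ereal \<delta>" using that unfolding S_def by simp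
    ultimately have "ereal \<delta> \<le> ereal (\<epsilon> * r\<^sup>2)" by (rule order_trans[rotated])
    with eps(2) show False by simp
  qed
  have "\<exists>\<gamma>>0. \<forall>x\<in>S. \<gamma> \<le> g x"
  proof (cases "S = {}")
    case True
    then show ?thesis by (auto intro: exI[of _ 1])
  next
    case False
    moreover have "continuous_on S g"
      by (rule continuous_on_subset[OF g]) (auto simp: S_def)
    ultimately obtain s where "s \<in> S" "\<forall>x\<in>S. g s \<le> g x"
      using continuous_attains_inf[OF S] by blast
    then show ?thesis using gS by blast
  qed
  then obtain \<gamma> where \<gamma>: "\<gamma> > 0" "\<And>x. x \<in> S \<Longrightarrow> \<gamma> \<le> g x" by blast
  \<comment> \<open>On \<open>S\<close> the penalty has to exceed \<open>C - \<delta>\<close>; the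
    form chosen is also nonnegative, so subtracting \<open>M * g\<close> raises no value
    anywhere.\<close>
  define M where "M = (\<bar>C\<bar> + 1) / \<gamma>"
  have M: "M \<ge> 0" "M * \<gamma> > C - \<delta>" using \<gamma>(1) \<delta>(2) by (auto simp: M_def)
  define H where "H x = F x - ereal (M * g x)" for x
  have H: "usc_on (cball c r) H"
    unfolding H_def by (intro usc_on_minus_continuous F continuous_intros g)
  obtain x0 where x0: "x0 \<in> cball c r" "\<And>x. x \<in> cball c r \<Longrightarrow> H x \<le> H x0"
    using usc_on_compact_attains_sup[OF H compact_cball nonempty] by blast
  have "H y = F y" unfolding H_def by (simp add: y(2))
  then have Hx0: "H x0 > ereal \<delta>" using x0(2)[OF y(1)] Fy by simp
  have "x0 \<notin> sphere c r"
  proof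
    assume sph: "x0 \<in> sphere c r"
    have "H x0 \<le> F x0" unfolding H_def using M(1) g_nonneg[of x0]
      by (cases "F x0") auto
    then have "F x0 \<ge> ereal \<delta>" using Hx0 by simp
    then have "x0 \<in> S" using sph unfolding S_def by simp
    then have "M * \<gamma> \<le> M * g x0" using \<gamma>(2) M(1) by (intro mult_left_mono) auto
    moreover have "F x0 \<le> ereal C" using m(2)[OF x0(1)] C by simp
    ultimately have "H x0 \<le> ereal (C - M * \<gamma>)" unfolding H_def by (cases "F x0") auto
    also have "\<dots> < ereal \<delta>" using M(2) by simp
    finally show False using Hx0 by simp
  qed
  then have ball: "x0 \<in> ball c r" using x0(1) by auto
  have "f x0 \<noteq> \<infinity>" using f x0(1) unfolding usc_on_def by blast
  moreover have "f x0 \<noteq> -\<infinity>" using Hx0 unfolding H_def F_def by auto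
  ultimately obtain \<alpha> where \<alpha>: "f x0 = ereal \<alpha>" by (cases "f x0") auto
  show ?thesis
  proof (rule that[OF eps(1) ball \<alpha>, where M = M])
    fix x assume "x \<in> cball c r"
    from x0(2)[OF this] show "f x \<le> ereal (\<alpha> + (\<phi> x - \<epsilon> * (norm (x - c))\<^sup>2 + M * g x)
         - (\<phi> x0 - \<epsilon> * (norm (x0 - c))\<^sup>2 + M * g x0))"
      unfolding H_def F_def k_def \<alpha> by (cases "f x") auto
  qed
qed

text \<open>\<open>T\<close> is the orthogonal projection onto the complement of \<open>L\<close>.
  The squared norm of \<open>T v\<close> serves as a polynomial squared distance to
  \<open>L\<close>, and \<open>v - T v\<close> as a retraction that extends linear maps from
  \<open>L\<close>.\<close>

lemma projection_onto_subspace: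
  fixes L :: "'a::euclidean_space set"
  assumes L: "subspace L"
  obtains T :: "'a \<Rightarrow> 'a" where "linear T" "\<And>v. T v = 0 \<longleftrightarrow> v \<in> L" "\<And>v. v - T v \<in> L"
proof -
  obtain B where B: "B \<subseteq> L" "pairwise orthogonal B" "\<And>x. x \<in> B \<Longrightarrow> norm x = 1"
    "independent B" "card B = dim L" "span B = L"
    using orthonormal_basis_subspace[OF L] by blast
  have fin: "finite B" using B(4) by (rule independent_imp_finite)
  define p where "p v = (\<Sum>b\<in>B. (v \<bullet> b) *\<^sub>R b)" for v
  have pL: "p v \<in> L" for v
    unfolding p_def using B(1) L by (intro subspace_sum subspace_mul) auto
  have lin: "linear p"
    unfolding p_def
    by (rule linearI) (simp_all add: inner_add_left scaleR_add_left sum.distrib scaleR_sum_right)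
  have pB: "p v = v" if "v \<in> B" for v
  proof -
    have "p v = (\<Sum>b\<in>B. if b = v then v else 0)"
      unfolding p_def
    proof (rule sum.cong)
      fix b assume "b \<in> B"
      then show "(v \<bullet> b) *\<^sub>R b = (if b = v then v else 0)"
        using B(2,3) that unfolding pairwise_def orthogonal_def
        by (auto simp: dot_square_norm)
    qed simp
    then show ?thesis using fin that by simp
  qed
  have pid: "p v = v" if "v \<in> L" for v
    using linear_eq_on[OF lin linear_id, of v B] pB that B(6) by simp
  show ?thesis
  proof (rule that[of "\<lambda>v. v - p v"])
    show "linear (\<lambda>v. v - p v)" by (intro linear_compose_sub linear_id lin[unfolded id_def] linear_ident)
    show "v - p v = 0 \<longleftrightarrow> v \<in> L" for v using pid pL[of v] by force
    show "v - (v - p v) \<in> L" for v using pL by simp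
  qed
qed

section \<open>Pluriharmonic functions\<close>

text \<open>Used for restrictions to complex lines. The new second derivative depends on the old one
  through a bounded linear map (\<open>bb\<close>), which yields its continuity.\<close>

lemma C2_compose_linear:
  fixes f :: "'a::euclidean_space \<Rightarrow> real" and A :: "'b::euclidean_space \<Rightarrow>\<^sub>L 'a"
  assumes C2: "C2_on_with U f f' f''"
  shows "C2_on_with {y. a + A y \<in> U} (\<lambda>y. f (a + A y)) (\<lambda>y. f' (a + A y) o\<^sub>L A)
     (\<lambda>y. Blinfun (\<lambda>v. f'' (a + A y) (A v) o\<^sub>L A))"
proof -
  have comp: "bounded_linear (\<lambda>g :: 'a \<Rightarrow>\<^sub>L real. g o\<^sub>L A)"
    by (rule bounded_bilinear.bounded_linear_left[OF bounded_bilinear_blinfun_compose])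
  have bl: "bounded_linear (\<lambda>v. H (A v) o\<^sub>L A)" for H :: "'a \<Rightarrow>\<^sub>L 'a \<Rightarrow>\<^sub>L real"
    by (intro bounded_linear_compose[OF comp] bounded_linear_compose[OF blinfun.bounded_linear_right]
        blinfun.bounded_linear_right)
  have dA: "((\<lambda>y. a + A y) has_derivative A) (at y)" for y
    by (auto intro!: derivative_eq_intros)
  have app: "blinfun_apply (Blinfun (\<lambda>v. H (A v) o\<^sub>L A)) v = H (A v) o\<^sub>L A" for H :: "'a \<Rightarrow>\<^sub>L 'a \<Rightarrow>\<^sub>L real" and v
    using bl[of H] by (simp add: bounded_linear_Blinfun_apply)
  have bb: "bounded_linear (\<lambda>H :: 'a \<Rightarrow>\<^sub>L 'a \<Rightarrow>\<^sub>L real. Blinfun (\<lambda>v. H (A v) o\<^sub>L A))"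
    (is "bounded_linear ?G")
  proof -
    have "linear ?G"
    proof (rule linearI)
      fix H1 H2 :: "'a \<Rightarrow>\<^sub>L 'a \<Rightarrow>\<^sub>L real"
      show "?G (H1 + H2) = ?G H1 + ?G H2"
        by (intro blinfun_eqI, unfold app) (simp add: app blinfun.bilinear_simps)
    next
      fix c and H :: "'a \<Rightarrow>\<^sub>L 'a \<Rightarrow>\<^sub>L real"
      show "?G (c *\<^sub>R H) = c *\<^sub>R ?G H"
        by (intro blinfun_eqI, unfold app) (simp add: app blinfun.bilinear_simps)
    qed
    moreover have "norm (?G H) \<le> norm H * (norm A * norm A)" for H
    proof (rule norm_blinfun_bound)
      show "0 \<le> norm H * (norm A * norm A)" by simp
      fix v
      have "norm (?G H v) \<le> norm (H (A v)) * norm A"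
        unfolding app by (rule norm_blinfun_compose)
      also have "\<dots> \<le> (norm H * (norm A * norm v)) * norm A"
        by (intro mult_right_mono order_trans[OF norm_blinfun] mult_left_mono norm_blinfun) auto
      finally show "norm (?G H v) \<le> norm H * (norm A * norm A) * norm v" by (simp add: mult_ac)
    qed
    ultimately show ?thesis
      by (intro bounded_linear.intro) (auto simp: bounded_linear_axioms_def)
  qed
  show ?thesis
    unfolding C2_on_with_def
  proof (intro conjI ballI)
    fix y assume "y \<in> {y. a + A y \<in> U}"
    then have y: "a + A y \<in> U" by simp
    have "(f has_derivative f' (a + A y)) (at (a + A y))"
      using C2 y unfolding C2_on_with_def by blast
    from has_derivative_compose[OF dA this]
    show "((\<lambda>y. f (a + A y)) has_derivative (f' (a + A y) o\<^sub>L A)) (at y)"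
      by (rule has_derivative_eq_rhs) auto
    have "(f' has_derivative f'' (a + A y)) (at (a + A y))"
      using C2 y unfolding C2_on_with_def by blast
    from has_derivative_compose[OF dA this]
    have "((\<lambda>y. f' (a + A y)) has_derivative (\<lambda>v. f'' (a + A y) (A v))) (at y)" .
    from bounded_linear.has_derivative[OF comp this]
    have "((\<lambda>y. f' (a + A y) o\<^sub>L A) has_derivative (\<lambda>v. f'' (a + A y) (A v) o\<^sub>L A)) (at y)" .
    moreover have "blinfun_apply (Blinfun (\<lambda>v. f'' (a + A y) (A v) o\<^sub>L A)) = (\<lambda>v. f'' (a + A y) (A v) o\<^sub>L A)"
      by (rule ext) (rule app)
    ultimately show "((\<lambda>y. f' (a + A y) o\<^sub>L A) has_derivative
        Blinfun (\<lambda>v. f'' (a + A y) (A v) o\<^sub>L A)) (at y)" by simp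
  next
    have "continuous_on {y. a + A y \<in> U} (\<lambda>y. f'' (a + A y))"
      by (rule continuous_on_compose2[of U f''])
        (use C2 in \<open>auto simp: C2_on_with_def intro!: continuous_intros\<close>)
    then show "continuous_on {y. a + A y \<in> U} (\<lambda>y. Blinfun (\<lambda>v. f'' (a + A y) (A v) o\<^sub>L A))"
      using bounded_linear.continuous_on[OF bb] by blast
  qed
qed

text \<open>\<open>harmonic_on\<close> hides its derivatives behind an existential quantifier;
  uniqueness identifies them with those computed by the chain rule.\<close>

lemma C2_derivatives_unique:
  assumes "open S" "x \<in> S" "C2_on_with S f f' f''" "C2_on_with S f g' g''"
  shows "f' x = g' x" "f'' x = g'' x"
proof -
  have eq: "f' y = g' y" if "y \<in> S" for y
  proof -
    have "(f has_derivative f' y) (at y)" "(f has_derivative g' y) (at y)"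
      using that assms(3,4) unfolding C2_on_with_def by blast+
    then have "blinfun_apply (f' y) = g' y" by (rule has_derivative_unique)
    then show ?thesis by (simp add: blinfun_apply_inject)
  qed
  then show "f' x = g' x" using assms(2) by blast
  have f': "(f' has_derivative f'' x) (at x)" and g': "(g' has_derivative g'' x) (at x)"
    using assms unfolding C2_on_with_def by auto
  have "(f' has_derivative g'' x) (at x)"
    by (rule has_derivative_transform_within_open[OF g' assms(1,2)]) (use eq in auto)
  with f' have "blinfun_apply (f'' x) = g'' x" by (rule has_derivative_unique)
  then show "f'' x = g'' x" by (simp add: blinfun_apply_inject)
qed

definition complex_line :: "complex ^ 'n \<Rightarrow> complex \<Rightarrow>\<^sub>L (complex ^ 'n)" where
  "complex_line b = Blinfun (\<lambda>\<zeta>. \<zeta> *s b)"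

lemma complex_line_apply [simp]: "complex_line b \<zeta> = \<zeta> *s b"
proof -
  have "linear (\<lambda>\<zeta>. \<zeta> *s b)"
    by (rule linearI) (simp_all add: vec_eq_iff algebra_simps)
  then show ?thesis
    unfolding complex_line_def
    by (simp add: linear_conv_bounded_linear bounded_linear_Blinfun_apply)
qed

text \<open>Along the line a + \<zeta> b the directions 1 and \<i> become b and \<i> b, so the
  Laplacian on lines is the Levi form of \<open>h\<close> up to a constant factor. Every point of
  \<open>U\<close> is reached with \<zeta> = 0.\<close>

lemma pluriharmonic_on_iff:
  fixes h :: "complex ^ 'n \<Rightarrow> real"
  assumes "open U" and C2: "C2_on_with U h h' h''"
  shows "pluriharmonic_on U h \<longleftrightarrow> (\<forall>z\<in>U. \<forall>b. h'' z b b + h'' z (\<i> *s b) (\<i> *s b) = 0)"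
proof -
  let ?S = "\<lambda>a b. {\<zeta>. a + \<zeta> *s b \<in> U}"
  define H' where "H' a b = (\<lambda>\<zeta>. h' (a + complex_line b \<zeta>) o\<^sub>L complex_line b)" for a b
  define H'' where "H'' a b = (\<lambda>\<zeta>. Blinfun (\<lambda>v. h'' (a + complex_line b \<zeta>) (complex_line b v) o\<^sub>L complex_line b))" for a b
  have H: "C2_on_with (?S a b) (\<lambda>\<zeta>. h (a + \<zeta> *s b)) (H' a b) (H'' a b)" for a b
    using C2_compose_linear[OF C2, of a "complex_line b"] unfolding H'_def H''_def by simp
  have H''_apply: "H'' a b \<zeta> v w = h'' (a + \<zeta> *s b) (v *s b) (w *s b)" for a b \<zeta> v w
  proof -
    have "bounded_linear (\<lambda>v. h'' (a + complex_line b \<zeta>) (complex_line b v) o\<^sub>L complex_line b)"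
      by (intro bounded_linear_compose[OF bounded_bilinear.bounded_linear_left[OF bounded_bilinear_blinfun_compose]]
          bounded_linear_compose[OF blinfun.bounded_linear_right] blinfun.bounded_linear_right)
    from bounded_linear_Blinfun_apply[OF this] show ?thesis
      unfolding H''_def by simp
  qed
  have op: "open (?S a b)" for a b
  proof -
    have "?S a b = (\<lambda>\<zeta>. a + complex_line b \<zeta>) -` U" by auto
    also have "open \<dots>"
      by (rule open_vimage[OF \<open>open U\<close>]) (intro continuous_intros)
    finally show ?thesis .
  qed
  have "harmonic_on (?S a b) (\<lambda>\<zeta>. h (a + \<zeta> *s b)) \<longleftrightarrow>
      (\<forall>\<zeta>\<in>?S a b. H'' a b \<zeta> 1 1 + H'' a b \<zeta> \<i> \<i> = 0)" for a b
  proof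
    assume "harmonic_on (?S a b) (\<lambda>\<zeta>. h (a + \<zeta> *s b))"
    then obtain f' f'' where f: "C2_on_with (?S a b) (\<lambda>\<zeta>. h (a + \<zeta> *s b)) f' f''"
      "\<forall>\<zeta>\<in>?S a b. (\<Sum>v\<in>Basis. f'' \<zeta> v v) = 0"
      unfolding harmonic_on_def by blast
    show "\<forall>\<zeta>\<in>?S a b. H'' a b \<zeta> 1 1 + H'' a b \<zeta> \<i> \<i> = 0"
      using f(2) C2_derivatives_unique(2)[OF op _ f(1) H] by (simp add: Basis_complex_def)
  next
    assume "\<forall>\<zeta>\<in>?S a b. H'' a b \<zeta> 1 1 + H'' a b \<zeta> \<i> \<i> = 0"
    then show "harmonic_on (?S a b) (\<lambda>\<zeta>. h (a + \<zeta> *s b))"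
      unfolding harmonic_on_def using H[of a b] by (auto simp: Basis_complex_def intro!: exI)
  qed
  then have "pluriharmonic_on U h \<longleftrightarrow>
      (\<forall>a b \<zeta>. a + \<zeta> *s b \<in> U \<longrightarrow> h'' (a + \<zeta> *s b) b b + h'' (a + \<zeta> *s b) (\<i> *s b) (\<i> *s b) = 0)"
    unfolding pluriharmonic_on_def using C2 by (auto simp: H''_apply)
  also have "\<dots> \<longleftrightarrow> (\<forall>z\<in>U. \<forall>b. h'' z b b + h'' z (\<i> *s b) (\<i> *s b) = 0)"
    by (metis add.right_neutral vec.scale_zero_left)
  finally show ?thesis .
qed

text \<open>A symmetric real form that changes sign under \<i> is the real part of a complex
  quadratic form.\<close>

lemma pluriharmonic_quadratic:
  fixes \<Lambda> :: "complex ^ 'n \<Rightarrow> real" and \<Gamma> :: "complex ^ 'n \<Rightarrow> complex ^ 'n \<Rightarrow> real"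
  assumes \<Lambda>: "linear \<Lambda>" and \<Gamma>: "bilinear \<Gamma>"
    and sym: "\<And>v w. \<Gamma> v w = \<Gamma> w v" and i: "\<And>v. \<Gamma> (\<i> *s v) (\<i> *s v) = - \<Gamma> v v"
  shows "pluriharmonic_on UNIV (\<lambda>z. k + \<Lambda> (z - a) + \<Gamma> (z - a) (z - a))"
proof -
  interpret bounded_bilinear \<Gamma>
    using \<Gamma> bilinear_conv_bounded_bilinear by blast
  have bl: "bounded_linear (\<Gamma> v)" for v
    by (rule bounded_linear_right)
  define G where "G = Blinfun (\<lambda>v. Blinfun (\<Gamma> v))"
  have Gin: "blinfun_apply (Blinfun (\<Gamma> v)) = \<Gamma> v" for v
    by (rule bounded_linear_Blinfun_apply[OF bl])
  have "linear (\<lambda>v. Blinfun (\<Gamma> v))"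
    by (rule linearI) (auto intro!: blinfun_eqI simp: Gin blinfun.bilinear_simps add_left scaleR_left)
  then have "bounded_linear (\<lambda>v. Blinfun (\<Gamma> v))"
    by (simp add: linear_conv_bounded_linear)
  then have G: "G v w = \<Gamma> v w" for v w
    unfolding G_def by (simp add: bounded_linear_Blinfun_apply Gin)
  have bL: "bounded_linear \<Lambda>" using \<Lambda> by (simp add: linear_conv_bounded_linear)
  define D where "D z = Blinfun \<Lambda> + 2 *\<^sub>R G (z - a)" for z
  have "C2_on_with UNIV (\<lambda>z. k + \<Lambda> (z - a) + \<Gamma> (z - a) (z - a)) D (\<lambda>z. 2 *\<^sub>R G)"
    unfolding C2_on_with_def
  proof (intro conjI ballI)
    fix z
    have "((\<lambda>z. k + \<Lambda> (z - a) + \<Gamma> (z - a) (z - a)) has_derivative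
        (\<lambda>v. 0 + \<Lambda> (v - 0) + (\<Gamma> (z - a) (v - 0) + \<Gamma> (v - 0) (z - a)))) (at z)"
      by (intro has_derivative_add has_derivative_const FDERIV has_derivative_diff has_derivative_ident
          bounded_linear.has_derivative[OF bL])
    moreover have "(\<lambda>v. 0 + \<Lambda> (v - 0) + (\<Gamma> (z - a) (v - 0) + \<Gamma> (v - 0) (z - a))) = D z"
      by (rule ext) (simp add: D_def blinfun.bilinear_simps bounded_linear_Blinfun_apply[OF bL] G
          diff_left diff_right sym[of _ z] sym[of _ a])
    ultimately show "((\<lambda>z. k + \<Lambda> (z - a) + \<Gamma> (z - a) (z - a)) has_derivative D z) (at z)" by simp
    have "(D has_derivative (\<lambda>v. 0 + 2 *\<^sub>R G (v - 0))) (at z)"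
      unfolding D_def
      by (intro has_derivative_add has_derivative_const has_derivative_diff has_derivative_ident
          has_derivative_scaleR_right bounded_linear.has_derivative[OF blinfun.bounded_linear_right])
    then show "(D has_derivative (2 *\<^sub>R G)) (at z)"
      by (rule has_derivative_eq_rhs) (auto simp: blinfun.bilinear_simps)
  qed (intro continuous_intros)
  from pluriharmonic_on_iff[OF open_UNIV this] show ?thesis
    by (simp add: blinfun.bilinear_simps G i)
qed

text \<open>The mean value theorem on the segment reduces the remainder to the increment of
  \<open>f'\<close> minus its linearization, which is small because \<open>f'\<close> is
  differentiable at \<open>x\<close>.\<close>

lemma taylor2_little_o:
  fixes f :: "'a::euclidean_space \<Rightarrow> real"
  assumes "open S" "x \<in> S" and C2: "C2_on_with S f f' f''" and "\<eta> > 0"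
  obtains \<delta> where "\<delta> > 0" "\<And>v. norm v < \<delta> \<Longrightarrow> \<bar>f (x + v) - f x - f' x v - f'' x v v / 2\<bar> \<le> \<eta> * (norm v)\<^sup>2"
proof -
  have d2: "(f' has_derivative f'' x) (at x)" using C2 assms(2) unfolding C2_on_with_def by blast
  then obtain \<delta>1 where \<delta>1: "\<delta>1 > 0"
    "\<And>y. norm (y - x) < \<delta>1 \<Longrightarrow> norm (f' y - f' x - f'' x (y - x)) \<le> \<eta> * norm (y - x)"
    using \<open>\<eta> > 0\<close> unfolding has_derivative_at_alt by blast
  obtain \<delta>2 where \<delta>2: "\<delta>2 > 0" "ball x \<delta>2 \<subseteq> S" using assms(1,2) open_contains_ball by blast
  show ?thesis
  proof (rule that[of "min \<delta>1 \<delta>2"])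
    show "min \<delta>1 \<delta>2 > 0" using \<delta>1 \<delta>2 by simp
    fix v :: 'a assume v: "norm v < min \<delta>1 \<delta>2"
    define g where "g t = f (x + t *\<^sub>R v) - t * f' x v - t\<^sup>2 / 2 * f'' x v v" for t
    define g' where "g' t = (\<lambda>s. s * ((f' (x + t *\<^sub>R v) - f' x - f'' x (t *\<^sub>R v)) v))" for t
    have small: "norm (t *\<^sub>R v) \<le> norm v" if "0 \<le> t" "t \<le> 1" for t
      using that mult_right_mono[of t 1 "norm v"] by simp
    have "\<exists>t\<in>{0<..<1}. g 1 - g 0 = g' t (1 - 0)"
    proof (rule mvt_simple)
      fix t :: real assume t: "0 \<le> t" "t \<le> 1"
      have "x + t *\<^sub>R v \<in> S"
        using small[OF t] v by (intro subsetD[OF \<delta>2(2)]) (simp add: dist_norm)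
      then have "(f has_derivative f' (x + t *\<^sub>R v)) (at (x + t *\<^sub>R v))"
        using C2 unfolding C2_on_with_def by blast
      moreover have "((\<lambda>t. x + t *\<^sub>R v) has_derivative (\<lambda>s. s *\<^sub>R v)) (at t within {0..1})"
        by (auto intro!: derivative_eq_intros)
      ultimately have "((\<lambda>t. f (x + t *\<^sub>R v)) has_derivative (\<lambda>s. f' (x + t *\<^sub>R v) (s *\<^sub>R v))) (at t within {0..1})"
        by (rule has_derivative_compose[rotated])
      then show "(g has_derivative g' t) (at t within {0..1})"
        unfolding g_def g'_def
        by (auto intro!: derivative_eq_intros simp: blinfun.bilinear_simps algebra_simps)
    qed simp
    then obtain t where t: "0 < t" "t < 1" "g 1 - g 0 = g' t 1" by auto
    have "norm (f' (x + t *\<^sub>R v) - f' x - f'' x (t *\<^sub>R v)) \<le> \<eta> * norm (t *\<^sub>R v)"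
      using \<delta>1(2)[of "x + t *\<^sub>R v"] small[of t] t v by simp
    also have "\<dots> \<le> \<eta> * norm v" using small[of t] t \<open>\<eta> > 0\<close> by (intro mult_left_mono) auto
    finally have "\<bar>g' t 1\<bar> \<le> \<eta> * norm v * norm v"
      unfolding g'_def using norm_blinfun[of "f' (x + t *\<^sub>R v) - f' x - f'' x (t *\<^sub>R v)" v]
        mult_right_mono[of _ "\<eta> * norm v" "norm v"]
      by (metis mult_1 norm_ge_zero order_trans real_norm_def)
    moreover have "g' t 1 = f (x + v) - f x - f' x v - f'' x v v / 2"
      using t(3) unfolding g_def by simp
    ultimately show "\<bar>f (x + v) - f x - f' x v - f'' x v v / 2\<bar> \<le> \<eta> * (norm v)\<^sup>2"
      by (simp add: power2_eq_square)
  qed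
qed

section \<open>Real and complex subspaces\<close>

text \<open>Each functional costs at most one dimension: a single vector on which it does not
  vanish, together with its kernel, spans the previous space.\<close>

lemma dim_common_kernel:
  fixes L :: "'a::euclidean_space set" and f :: "'i \<Rightarrow> 'a \<Rightarrow> real"
  assumes "finite I" "subspace L" "\<And>i. i \<in> I \<Longrightarrow> linear (f i)"
  shows "subspace {w \<in> L. \<forall>i\<in>I. f i w = 0} \<and> dim L \<le> dim {w \<in> L. \<forall>i\<in>I. f i w = 0} + card I"
  using assms
proof (induction I rule: finite_induct)
  case empty
  then show ?case by simp
next
  case (insert j I)
  let ?E = "{w \<in> L. \<forall>i\<in>I. f i w = 0}" and ?E' = "{w \<in> L. \<forall>i\<in>insert j I. f i w = 0}"
  have IH: "subspace ?E" "dim L \<le> dim ?E + card I" using insert by auto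
  have lin: "linear (f j)" using insert by simp
  have E': "?E' = {w \<in> ?E. f j w = 0}" by auto
  have sub: "subspace ?E'"
    unfolding E' using IH(1) lin
    by (auto simp: subspace_def linear_0 linear_add linear_scale)
  have "dim ?E \<le> dim ?E' + 1"
  proof (cases "\<exists>e\<in>?E. f j e \<noteq> 0")
    case False
    then have "?E' = ?E" unfolding E' by auto
    then show ?thesis by simp
  next
    case True
    then obtain e where e: "e \<in> ?E" "f j e \<noteq> 0" by blast
    have "?E \<subseteq> span (insert e ?E')"
    proof
      fix w assume w: "w \<in> ?E"
      define k where "k = f j w / f j e"
      have "w - k *\<^sub>R e \<in> ?E"
        using IH(1) w e(1) by (intro subspace_diff subspace_scale)
      moreover have "f j (w - k *\<^sub>R e) = 0"
        using lin e(2) by (simp add: linear_diff linear_scale k_def)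
      ultimately have "w - k *\<^sub>R e \<in> ?E'" unfolding E' by simp
      then show "w \<in> span (insert e ?E')"
        unfolding span_breakdown_eq by (auto intro: span_base)
    qed
    then have "dim ?E \<le> dim (insert e ?E')" using dim_subset[of ?E "span (insert e ?E')"] by (simp only: dim_span)
    then show ?thesis unfolding dim_insert by (rule order_trans) simp
  qed
  moreover have "card (insert j I) = card I + 1" using insert(1,2) by simp
  ultimately show ?case using IH(2) sub by (intro conjI) linarith+
qed

lemma common_kernel_nontrivial:
  fixes L :: "'a::euclidean_space set" and f :: "'i \<Rightarrow> 'a \<Rightarrow> real"
  assumes "finite I" "subspace L" "\<And>i. i \<in> I \<Longrightarrow> linear (f i)" "card I < dim L"
  obtains w where "w \<in> L" "w \<noteq> 0" "\<And>i. i \<in> I \<Longrightarrow> f i w = 0"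
proof -
  let ?E = "{w \<in> L. \<forall>i\<in>I. f i w = 0}"
  have "dim L \<le> dim ?E + card I" using dim_common_kernel[of I L f] assms(1-3) by blast
  then have "dim ?E \<noteq> 0" using assms(4) by linarith
  then have "\<not> ?E \<subseteq> {0}" by (simp add: dim_eq_0)
  then show ?thesis using that by blast
qed

lemma complex_scale_of_real: "complex_of_real r *s (v :: complex ^ 'n) = r *\<^sub>R v"
  by (simp add: vec_eq_iff scaleR_conv_of_real[where 'a = complex])

lemma complex_scale_split: "c *s (v :: complex ^ 'n) = Re c *\<^sub>R v + Im c *\<^sub>R (\<i> *s v)"
  by (simp add: vec_eq_iff complex_eq_iff)

lemma vec_subspace_imp_subspace:
  fixes L :: "(complex ^ 'n) set"
  assumes "vec.subspace L"
  shows "subspace L"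
  unfolding subspace_def
proof (intro conjI ballI allI)
  fix c :: real and x assume "x \<in> L"
  from vec.subspace_scale[OF assms this, of "of_real c"] show "c *\<^sub>R x \<in> L"
    by (simp only: complex_scale_of_real)
qed (use assms vec.subspace_0 vec.subspace_add in blast)+

text \<open>Each complex basis vector b adds two real dimensions: if \<i> b - k b with real k were
  in the span S of the earlier ones, dividing by \<i> - k would put b into S.\<close>

lemma real_dim_complex_subspace:
  fixes L :: "(complex ^ 'n) set"
  assumes "vec.subspace L"
  shows "2 * vec.dim L \<le> dim L"
proof -
  have "2 * card B \<le> dim (vec.span B)" if "finite B" "vec.independent B" for B :: "(complex ^ 'n) set"
    using that
  proof (induction B rule: finite_induct)
    case empty
    then show ?case by simp
  next
    case (insert b B)
    let ?S = "vec.span B" and ?T = "vec.span (insert b B)"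
    have ind: "vec.independent B" "b \<notin> ?S"
      using insert by (simp_all add: vec.independent_insert)
    have sp: "span ?S = ?S"
      by (simp add: vec_subspace_imp_subspace)
    have "\<i> *s b \<notin> span (insert b ?S)"
    proof
      assume "\<i> *s b \<in> span (insert b ?S)"
      then obtain k where "\<i> *s b - k *\<^sub>R b \<in> ?S" unfolding span_breakdown_eq sp by blast
      moreover have "\<i> *s b - k *\<^sub>R b = (\<i> - of_real k) *s b"
        by (simp add: vec_eq_iff scaleR_conv_of_real[where 'a = complex] algebra_simps)
      ultimately have "inverse (\<i> - of_real k) *s ((\<i> - of_real k) *s b) \<in> ?S"
        by (metis vec.span_scale)
      moreover have "\<i> - of_real k \<noteq> 0" by (simp add: complex_eq_iff)
      ultimately show False using ind(2) by (metis vec.scale_scale left_inverse vec.scale_one)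
    qed
    then have "dim (insert (\<i> *s b) (insert b ?S)) = dim ?S + 2"
      using ind(2) by (simp add: dim_insert sp)
    moreover have "insert (\<i> *s b) (insert b ?S) \<subseteq> ?T"
      using vec.span_mono[OF subset_insertI[of B b]] vec.span_scale[OF vec.span_base[OF insertI1[of b B]], of \<i>]
        vec.span_base[OF insertI1[of b B]] by simp
    ultimately have "dim ?S + 2 \<le> dim ?T" by (metis dim_subset)
    then show ?case using insert ind by simp
  qed
  moreover obtain B where B: "B \<subseteq> L" "vec.independent B" "L \<subseteq> vec.span B" "card B = vec.dim L"
    using vec.basis_exists[of L] by blast
  moreover have "vec.span B = L"
    using B(1,3) assms by (rule vec.span_subspace)
  moreover have "finite B" using B(2) by (rule vec.finiteI_independent)
  ultimately show ?thesis by fastforce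
qed

section \<open>Real and imaginary parts, diagonal scalings and complexified subspaces\<close>

definition Re_vec :: "complex ^ 'n \<Rightarrow> real ^ 'n" where "Re_vec w = (\<chi> i. Re (w $ i))"
definition Im_vec :: "complex ^ 'n \<Rightarrow> real ^ 'n" where "Im_vec w = (\<chi> i. Im (w $ i))"

lemma linear_Re_vec: "linear Re_vec" and linear_Im_vec: "linear Im_vec"
  by (rule linearI; simp add: vec_eq_iff Re_vec_def Im_vec_def)+

lemma Re_vec_ii [simp]: "Re_vec (\<i> *s w) = - Im_vec w"
  and Im_vec_ii [simp]: "Im_vec (\<i> *s w) = Re_vec w"
  by (simp_all add: vec_eq_iff Re_vec_def Im_vec_def)

lemma norm_Re_Im_vec: "(norm (Re_vec w))\<^sup>2 + (norm (Im_vec w))\<^sup>2 = (norm w)\<^sup>2"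
  unfolding norm_vec_def L2_set_def Re_vec_def Im_vec_def
  by (simp add: sum_nonneg cmod_def sum.distrib)

text \<open>Multiplication by \<open>z0\<close> or its inverse passes between displacements z - z0
  and relative displacements w with z = z0 (1 + w), in which the logarithm has the same expansion at
  every base point.\<close>

definition scale_by :: "('n \<Rightarrow> complex) \<Rightarrow> complex ^ 'n \<Rightarrow> complex ^ 'n" where
  "scale_by d w = (\<chi> i. d i * w $ i)"

lemma linear_scale_by: "linear (scale_by d)"
  by (rule linearI) (simp_all add: vec_eq_iff scale_by_def algebra_simps)

lemma scale_by_complex_linear: "scale_by d (c *s w) = c *s scale_by d w"
  by (simp add: vec_eq_iff scale_by_def)

lemma scale_by_add: "scale_by d (v + w) = scale_by d v + scale_by d w"
  by (rule linear_add[OF linear_scale_by])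

lemma scale_by_inverse:
  assumes "\<And>i. d i \<noteq> 0"
  shows "scale_by (\<lambda>i. inverse (d i)) (scale_by d w) = w"
    and "scale_by d (scale_by (\<lambda>i. inverse (d i)) w) = w"
  using assms by (simp_all add: vec_eq_iff scale_by_def field_simps)

text \<open>Scaling by \<open>d\<close> pulls the complexification \<open>R \<otimes> \<complex>\<close> of a real subspace back to \<open>d\<^sup>-\<^sup>1 (R \<otimes> \<complex>)\<close>.\<close>

lemma complexified_subspace:
  fixes R :: "(real ^ 'n) set"
  assumes R: "subspace R" and d: "\<And>i. d i \<noteq> 0"
  obtains L where "vec.subspace L" "vec.dim L = dim R"
    "\<And>w. w \<in> L \<Longrightarrow> Re_vec (scale_by d w) \<in> R \<and> Im_vec (scale_by d w) \<in> R"
proof -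
  obtain B where B: "B \<subseteq> R" "independent B" "R \<subseteq> span B" "card B = dim R"
    using basis_exists by blast
  define e where "e b = scale_by (\<lambda>i. inverse (d i)) (\<chi> i. complex_of_real (b $ i))" for b
  have e: "Re_vec (scale_by d (e b)) = b" "Im_vec (scale_by d (e b)) = 0" for b
    unfolding e_def scale_by_inverse(2)[OF d] by (simp_all add: vec_eq_iff Re_vec_def Im_vec_def)
  have span: "Re_vec (scale_by d w) \<in> span C \<and> Im_vec (scale_by d w) \<in> span C"
    if "w \<in> vec.span (e ` C)" for w C
    using that
  proof (induction rule: vec.span_induct_alt)
    case base
    show ?case
      by (simp add: linear_0[OF linear_scale_by] linear_0[OF linear_Re_vec] linear_0[OF linear_Im_vec] span_zero)
  next
    case (step c x y)
    then obtain b where b: "b \<in> C" "x = e b" by blast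
    have "Re_vec (scale_by d (c *s x + y)) = Re c *\<^sub>R b + Re_vec (scale_by d y)"
      "Im_vec (scale_by d (c *s x + y)) = Im c *\<^sub>R b + Im_vec (scale_by d y)"
      using e[of b] unfolding b scale_by_add scale_by_complex_linear
      by (simp_all add: complex_scale_split[of c] linear_add[OF linear_Re_vec] linear_add[OF linear_Im_vec]
          linear_scale[OF linear_Re_vec] linear_scale[OF linear_Im_vec])
    then show ?case using step b by (auto intro!: span_add span_scale intro: span_base)
  qed
  have inj: "inj e" using e(1) by (metis injI)
  have "vec.independent (e ` C)" if "finite C" "independent C" for C
    using that
  proof (induction C rule: finite_induct)
    case empty
    then show ?case by (simp add: vec.independent_empty)
  next
    case (insert b C)
    then have "b \<notin> span C" "independent C" by (simp_all add: independent_insert)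
    \<comment> \<open>Taking real parts turns a complex dependence among the \<open>e b\<close> into
      a real one.\<close>
    then have "e b \<notin> vec.span (e ` C)" using span[of "e b" C] e(1)[of b] by auto
    then show ?case using insert \<open>independent C\<close> by (simp add: vec.independent_insertI)
  qed
  then have ind: "vec.independent (e ` B)" using B(2) independent_imp_finite by blast
  show ?thesis
  proof (rule that[of "vec.span (e ` B)"])
    show "vec.dim (vec.span (e ` B)) = dim R"
      using vec.dim_span_eq_card_independent[OF ind] card_image[OF inj_on_subset[OF inj]] B(4) by auto
    show "Re_vec (scale_by d w) \<in> R \<and> Im_vec (scale_by d w) \<in> R" if "w \<in> vec.span (e ` B)" for w
      using span[OF that] B(1) R span_minimal by blast
  qed simp
qed

text \<open>A vector \<open>w\<close> that is orthogonal to \<open>N\<close> together with \<open>\<i> w\<close> allows to enlarge \<open>N\<close>, as one of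
  \<open>B w w\<close> and \<open>B (\<i> w) (\<i> w)\<close> is negative. It exists by counting dimensions over the reals.\<close>

lemma real_negative_subspace:
  fixes L :: "(complex ^ 'n) set" and B :: "complex ^ 'n \<Rightarrow> complex ^ 'n \<Rightarrow> real"
  assumes L: "vec.subspace L" and B: "bilinear B"
    and neg: "\<And>v. v \<in> L \<Longrightarrow> v \<noteq> 0 \<Longrightarrow> B v v + B (\<i> *s v) (\<i> *s v) < 0"
    and k: "k \<le> vec.dim L"
  shows "\<exists>N. subspace N \<and> N \<subseteq> L \<and> dim N = k \<and> (\<forall>v\<in>N. v \<noteq> 0 \<longrightarrow> B v v < 0)"
  using k
proof (induction k)
  case 0
  then show ?case using L by (intro exI[of _ "{0}"]) (auto simp: vec.subspace_0)
next
  case (Suc k)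
  then obtain N where N: "subspace N" "N \<subseteq> L" "dim N = k" "\<forall>v\<in>N. v \<noteq> 0 \<longrightarrow> B v v < 0" by auto
  have sL: "subspace L" using L by (rule vec_subspace_imp_subspace)
  obtain D where D: "D \<subseteq> N" "independent D" "N \<subseteq> span D" "card D = k"
    using basis_exists[of N] N(3) by metis
  have finD: "finite D" using D(2) by (rule independent_imp_finite)
  \<comment> \<open>\<open>B\<close> is not assumed symmetric, so orthogonality to \<open>n\<close>
    is stated as the vanishing of the sum of both cross terms.\<close>
  define f where "f = (\<lambda>(n, c). \<lambda>w. B n (c *s w) + B (c *s w) n)"
  note bl = bilinear_ladd[OF B] bilinear_radd[OF B] bilinear_lmul[OF B] bilinear_rmul[OF B]
    bilinear_lzero[OF B] bilinear_rzero[OF B]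
  have "linear (f p)" for p
  proof -
    obtain n c where p: "p = (n, c)" by (cases p)
    have "c *s (r *\<^sub>R v) = r *\<^sub>R (c *s v)" for r and v :: "complex ^ 'n"
      by (simp add: vec_eq_iff)
    then show ?thesis
      by (intro linearI) (simp_all add: f_def p bl vec.scale_right_distrib distrib_left)
  qed
  \<comment> \<open>There are 2k real conditions against at least 2(k + 1) real dimensions.\<close>
  moreover have "card (D \<times> {1, \<i>}) < dim L"
    using real_dim_complex_subspace[OF L] Suc.prems D(4) by (simp add: card_cartesian_product)
  ultimately obtain w where w: "w \<in> L" "w \<noteq> 0" "\<And>p. p \<in> D \<times> {1, \<i>} \<Longrightarrow> f p w = 0"
    using common_kernel_nontrivial[of "D \<times> {1, \<i>}" L f] finD sL by auto
  have orth: "B n (c *s w) + B (c *s w) n = 0" if "n \<in> N" "c \<in> {1, \<i>}" for n c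
  proof -
    have "linear (\<lambda>n. B n (c *s w) + B (c *s w) n)"
      by (rule linearI) (simp_all add: bl distrib_left)
    moreover have "B n (c *s w) + B (c *s w) n = 0" if "n \<in> D" for n
      using w(3)[of "(n, c)"] that \<open>c \<in> {1, \<i>}\<close> unfolding f_def by auto
    ultimately show ?thesis
      using linear_eq_0_on_span that(1) D(3) by blast
  qed
  have "\<exists>c\<in>{1, \<i>}. B (c *s w) (c *s w) < 0"
    using neg[OF w(1,2)] by (cases "B w w < 0") auto
  then obtain c where c: "c \<in> {1, \<i>}" "B (c *s w) (c *s w) < 0" by blast
  define x where "x = c *s w"
  have x: "x \<in> L" "B x x < 0" "\<And>n. n \<in> N \<Longrightarrow> B n x + B x n = 0"
    using w(1) c orth L unfolding x_def by (auto simp: vec.subspace_scale)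
  have "x \<notin> N" using x(2) x(3)[of x] by auto
  show ?case
  proof (intro exI[of _ "span (insert x N)"] conjI ballI impI)
    show "span (insert x N) \<subseteq> L" using sL N(2) x(1) by (intro span_minimal) auto
    show "dim (span (insert x N)) = Suc k"
      using \<open>x \<notin> N\<close> N(1,3) by (simp add: dim_insert span_eq_iff[THEN iffD2])
    fix v assume v: "v \<in> span (insert x N)" "v \<noteq> 0"
    then obtain t where "v - t *\<^sub>R x \<in> N"
      using N(1) by (auto simp: span_breakdown_eq span_eq_iff[THEN iffD2])
    then obtain n where n: "n \<in> N" "v = n + t *\<^sub>R x" by (metis diff_add_cancel)
    have "B v v = B n n + t * (B n x + B x n) + t\<^sup>2 * B x x"
      unfolding n(2) by (simp add: bl algebra_simps power2_eq_square)
    then have eq: "B v v = B n n + t\<^sup>2 * B x x" using x(3)[OF n(1)] by simp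
    show "B v v < 0"
    proof (cases "n = 0")
      case True
      then have "t \<noteq> 0" using v(2) n(2) by auto
      then show ?thesis using eq True x(2) by (simp add: bl mult_pos_neg)
    next
      case False
      then have "B n n < 0" using N(4) n(1) by blast
      then show ?thesis using eq x(2) by (smt (verit) mult_nonneg_nonpos zero_le_power2)
    qed
  qed simp
qed

section \<open>Second-order estimates\<close>

text \<open>For a displacement \<open>s\<close> after a change of coordinates, \<open>p\<close> is
  its second-order and \<open>d\<close> its first-order approximation. The linear term needs the
  finer one, while in the quadratic term the coarser one already leaves a cubic error.\<close>

lemma quadratic_perturbation:
  fixes \<Lambda> :: "'a::euclidean_space \<Rightarrow> real" and B :: "'a \<Rightarrow> 'a \<Rightarrow> real"
  assumes \<Lambda>: "linear \<Lambda>" and B: "bilinear B" and K: "K \<ge> 0"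
  obtains K' where "K' \<ge> 0"
    "\<And>s p d \<rho>. \<lbrakk>norm (s - p) \<le> K * \<rho> ^ 3; norm (s - d) \<le> K * \<rho>\<^sup>2; norm s \<le> K * \<rho>; norm d \<le> K * \<rho>; \<rho> \<ge> 0\<rbrakk>
       \<Longrightarrow> \<bar>\<Lambda> s + B s s - (\<Lambda> p + B d d)\<bar> \<le> K' * \<rho> ^ 3"
proof -
  obtain K1 where K1: "K1 > 0" "\<And>x. \<bar>\<Lambda> x\<bar> \<le> norm x * K1"
    using bounded_linear.pos_bounded[of \<Lambda>] \<Lambda> by (auto simp: linear_conv_bounded_linear)
  obtain K2 where K2: "K2 > 0" "\<And>x y. \<bar>B x y\<bar> \<le> norm x * norm y * K2"
    using bounded_bilinear.pos_bounded[of B] B by (auto simp: bilinear_conv_bounded_bilinear)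
  show ?thesis
  proof (rule that[of "K * K1 + 2 * K\<^sup>2 * K2"])
    show "K * K1 + 2 * K\<^sup>2 * K2 \<ge> 0" using K K1(1) K2(1) by simp
    fix s p d :: 'a and \<rho> :: real
    assume a: "norm (s - p) \<le> K * \<rho> ^ 3" "norm (s - d) \<le> K * \<rho>\<^sup>2" "norm s \<le> K * \<rho>" "norm d \<le> K * \<rho>" "\<rho> \<ge> 0"
    have "\<bar>\<Lambda> (s - p)\<bar> \<le> K * \<rho> ^ 3 * K1"
      using order_trans[OF K1(2)[of "s - p"] mult_right_mono[OF a(1)]] K1(1) by simp
    moreover have "\<bar>B (s - d) s\<bar> \<le> K * \<rho>\<^sup>2 * (K * \<rho>) * K2"
      using a K K2(1) by (intro order_trans[OF K2(2)] mult_right_mono mult_mono) auto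
    moreover have "\<bar>B d (s - d)\<bar> \<le> K * \<rho> * (K * \<rho>\<^sup>2) * K2"
      using a K K2(1) by (intro order_trans[OF K2(2)] mult_right_mono mult_mono) auto
    moreover have "\<Lambda> s + B s s - (\<Lambda> p + B d d) = \<Lambda> (s - p) + B (s - d) s + B d (s - d)"
      by (simp add: linear_diff[OF \<Lambda>] bilinear_lsub[OF B] bilinear_rsub[OF B])
    ultimately show "\<bar>\<Lambda> s + B s s - (\<Lambda> p + B d d)\<bar> \<le> (K * K1 + 2 * K\<^sup>2 * K2) * \<rho> ^ 3"
      by (simp add: algebra_simps power2_eq_square power3_eq_cube)
  qed
qed

lemma norm_vec_le_card:
  fixes x :: "'a::real_normed_vector ^ 'n"
  assumes "\<And>i. norm (x $ i) \<le> c"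
  shows "norm x \<le> real CARD('n) * c"
proof -
  have "norm x \<le> (\<Sum>i\<in>UNIV. norm (x $ i))"
    unfolding norm_vec_def by (rule L2_set_le_sum) simp
  also have "\<dots> \<le> (\<Sum>i\<in>(UNIV::'n set). c)" by (rule sum_mono) (rule assms)
  finally show ?thesis by simp
qed

text \<open>On the disc of radius 1/2 the third derivative 2 / (1 + w)^3 is at most 16, and the
  bound of \<open>complex_Taylor\<close> divides this by \<open>fact 2\<close>.\<close>

lemma Ln_one_plus_Taylor2:
  assumes "cmod z \<le> 1 / 2"
  shows "cmod (Ln (1 + z) - (z - z\<^sup>2 / 2)) \<le> 8 * cmod z ^ 3"
proof -
  define f where "f n w = (case n of 0 \<Rightarrow> Ln (1 + w) | Suc 0 \<Rightarrow> inverse (1 + w)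
    | Suc (Suc 0) \<Rightarrow> - inverse ((1 + w)\<^sup>2) | _ \<Rightarrow> 2 * inverse ((1 + w) ^ 3))" for n :: nat and w
  have pos: "Re (1 + w) \<ge> 1 / 2" "cmod (1 + w) \<ge> 1 / 2" if "w \<in> cball 0 (1 / 2)" for w
  proof -
    show "Re (1 + w) \<ge> 1 / 2" using abs_Re_le_cmod[of w] that by simp
    then show "cmod (1 + w) \<ge> 1 / 2" using complex_Re_le_cmod[of "1 + w"] by linarith
  qed
  have "cmod (f 0 z - (\<Sum>i\<le>2. f i 0 * (z - 0) ^ i / fact i)) \<le> 16 * cmod (z - 0) ^ Suc 2 / fact 2"
  proof (rule complex_Taylor[of "cball 0 (1 / 2)"])
    fix i and w :: complex assume w: "w \<in> cball 0 (1 / 2)" and "i \<le> (2::nat)"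
    have nz: "1 + w \<noteq> 0" "1 + w \<notin> \<real>\<^sub>\<le>\<^sub>0" using pos(1)[OF w]
      by (auto simp: complex_nonpos_Reals_iff complex_eq_iff)
    from \<open>i \<le> 2\<close> consider "i = 0" | "i = 1" | "i = 2" by linarith
    then show "(f i has_field_derivative f (Suc i) w) (at w within cball 0 (1 / 2))"
    proof cases
      case 1
      then show ?thesis unfolding f_def using nz
        by (auto intro!: derivative_eq_intros simp: field_simps)
    next
      case 2
      then show ?thesis unfolding f_def using nz
        by (auto intro!: derivative_eq_intros simp: field_simps power2_eq_square)
    next
      case 3
      have "((\<lambda>x. - inverse (x\<^sup>2)) has_field_derivative 2 * inverse (x ^ 3)) (at x)" if "x \<noteq> 0" for x :: complex
        using that by (auto intro!: derivative_eq_intros simp: power2_eq_square power3_eq_cube)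
      moreover have "((\<lambda>w. 1 + w) has_field_derivative 1) (at w within cball 0 (1 / 2))"
        by (auto intro!: derivative_eq_intros)
      ultimately      have "((\<lambda>w. - inverse ((1 + w)\<^sup>2)) has_field_derivative 2 * inverse ((1 + w) ^ 3) * 1) (at w within cball 0 (1 / 2))"
        using nz(1) by (intro DERIV_chain2[where g = "\<lambda>w. 1 + w" and f = "\<lambda>x. - inverse (x\<^sup>2)"]) auto
      then show ?thesis unfolding 3 by (simp add: f_def[abs_def] numeral_2_eq_2)
    qed
  next
    fix w :: complex assume w: "w \<in> cball 0 (1 / 2)"
    have "(1 / 2) ^ 3 \<le> cmod (1 + w) ^ 3" using pos(2)[OF w] by (intro power_mono) auto
    then have "inverse (cmod (1 + w) ^ 3) \<le> inverse ((1 / 2) ^ 3)" by (intro le_imp_inverse_le) auto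
    then show "cmod (f (Suc 2) w) \<le> 16"
      by (simp add: f_def norm_mult norm_inverse norm_power numeral_2_eq_2 power_divide)
  qed (use assms in auto)
  then show ?thesis by (simp add: f_def numeral_2_eq_2 power3_eq_cube algebra_simps)
qed

lemma exp_Taylor2:
  fixes z :: complex
  assumes "cmod z \<le> 1"
  shows "cmod (exp z - 1 - (z + z\<^sup>2 / 2)) \<le> 3 * cmod z ^ 3"
proof -
  have "exp \<bar>Re z\<bar> \<le> exp (1::real)" using abs_Re_le_cmod[of z] assms by simp
  also have "\<dots> \<le> 3" by (rule exp_le)
  finally have "exp \<bar>Re z\<bar> / 2 \<le> 3" by simp
  then have "exp \<bar>Re z\<bar> / 2 * cmod z ^ 3 \<le> 3 * cmod z ^ 3" by (intro mult_right_mono) auto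
  then show ?thesis using Taylor_exp[of z 2]
    by (simp add: numeral_2_eq_2 numeral_3_eq_3 algebra_simps)
qed

definition vec_prod :: "complex ^ 'n \<Rightarrow> complex ^ 'n \<Rightarrow> complex ^ 'n" where
  "vec_prod v w = (\<chi> i. v $ i * w $ i)"

lemma vec_prod_bilinear:
  "vec_prod (a + b) c = vec_prod a c + vec_prod b c" "vec_prod c (a + b) = vec_prod c a + vec_prod c b"
  "vec_prod (r *\<^sub>R a) c = r *\<^sub>R vec_prod a c" "vec_prod c (r *\<^sub>R a) = r *\<^sub>R vec_prod c a"
  by (simp_all add: vec_eq_iff vec_prod_def algebra_simps)

text \<open>This sign change is why the second-order terms of \<open>Ln\<close> and
  \<open>exp\<close> do not affect the Levi form.\<close>

lemma vec_prod_ii: "vec_prod (\<i> *s a) (\<i> *s a) = - vec_prod a a"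
  by (simp add: vec_eq_iff vec_prod_def complex_eq_iff algebra_simps)

text \<open>The four bounds are the premises of \<open>quadratic_perturbation\<close> for passing
  from relative displacements \<open>w\<close> to logarithmic ones \<open>t\<close>, with
  \<open>\<rho> = norm w\<close> and first-order part \<open>Re_vec w\<close>.\<close>

lemma ln_vec_estimate:
  fixes w :: "complex ^ 'n"
  assumes w: "norm w \<le> 1 / 2"
  defines "t \<equiv> (\<chi> i. ln (cmod (1 + w $ i)))" and "K \<equiv> 8 * real CARD('n)"
  shows "norm (t - Re_vec (w - (1 / 2) *\<^sub>R vec_prod w w)) \<le> K * norm w ^ 3"
    "norm (t - Re_vec w) \<le> K * (norm w)\<^sup>2" "norm t \<le> K * norm w" "norm (Re_vec w) \<le> K * norm w"
proof -
  let ?n = "norm w"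
  have comp: "cmod (w $ i) \<le> ?n" for i by (rule Finite_Cartesian_Product.norm_nth_le)
  have pow: "cmod (w $ i) ^ k \<le> ?n ^ k" for i k by (rule power_mono[OF comp]) simp
  have n2: "?n\<^sup>2 \<le> ?n / 2" and n3: "?n ^ 3 \<le> ?n\<^sup>2 / 2"
    using mult_right_mono[OF w, of ?n] mult_right_mono[OF w, of "?n\<^sup>2"]
    by (simp_all add: power2_eq_square power3_eq_cube)
  have 1: "\<bar>t $ i - Re (w $ i - (w $ i)\<^sup>2 / 2)\<bar> \<le> 8 * ?n ^ 3" for i
  proof -
    have small: "cmod (w $ i) \<le> 1 / 2" using comp[of i] w by simp
    have "1 + w $ i \<noteq> 0"
    proof
      assume "1 + w $ i = 0"
      then have "w $ i = -1" by (simp add: eq_neg_iff_add_eq_0 add.commute)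
      with small show False by simp
    qed
    then have "t $ i = Re (Ln (1 + w $ i))" by (simp add: t_def)
    then have "\<bar>t $ i - Re (w $ i - (w $ i)\<^sup>2 / 2)\<bar> \<le> cmod (Ln (1 + w $ i) - (w $ i - (w $ i)\<^sup>2 / 2))"
      using abs_Re_le_cmod[of "Ln (1 + w $ i) - (w $ i - (w $ i)\<^sup>2 / 2)"] by simp
    also have "\<dots> \<le> 8 * cmod (w $ i) ^ 3" by (rule Ln_one_plus_Taylor2[OF small])
    finally show ?thesis using pow[of i 3] by linarith
  qed
  have Re2: "\<bar>Re ((w $ i)\<^sup>2 / 2)\<bar> \<le> ?n\<^sup>2 / 2" for i
  proof -
    have "\<bar>Re ((w $ i)\<^sup>2 / 2)\<bar> \<le> cmod ((w $ i)\<^sup>2 / 2)" by (rule abs_Re_le_cmod)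
    then show ?thesis using order_trans[OF _ pow[of i 2]] by (simp add: norm_divide norm_power)
  qed
  have 2: "\<bar>t $ i - Re (w $ i)\<bar> \<le> 8 * ?n\<^sup>2" for i
    using 1[of i] Re2[of i] n3 by (simp add: minus_complex.sel)
  have 3: "\<bar>t $ i\<bar> \<le> 8 * ?n" for i
    using 2[of i] n2 abs_Re_le_cmod[of "w $ i"] comp[of i] by linarith
  have 4: "\<bar>Re (w $ i)\<bar> \<le> 8 * ?n" for i
    using abs_Re_le_cmod[of "w $ i"] comp[of i] norm_ge_zero[of w] by linarith
  have "norm ((t - Re_vec (w - (1 / 2) *\<^sub>R vec_prod w w)) $ i) \<le> 8 * ?n ^ 3" for i
    using 1[of i] by (simp add: Re_vec_def vec_prod_def power2_eq_square)
  from norm_vec_le_card[OF this]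
  show "norm (t - Re_vec (w - (1 / 2) *\<^sub>R vec_prod w w)) \<le> K * norm w ^ 3" by (simp add: K_def)
  have "norm ((t - Re_vec w) $ i) \<le> 8 * ?n\<^sup>2" for i using 2[of i] by (simp add: Re_vec_def)
  from norm_vec_le_card[OF this] show "norm (t - Re_vec w) \<le> K * (norm w)\<^sup>2" by (simp add: K_def)
  have "norm (t $ i) \<le> 8 * ?n" for i using 3[of i] by simp
  from norm_vec_le_card[OF this] show "norm t \<le> K * norm w" by (simp add: K_def)
  have "norm (Re_vec w $ i) \<le> 8 * ?n" for i using 4[of i] by (simp add: Re_vec_def)
  from norm_vec_le_card[OF this] show "norm (Re_vec w) \<le> K * norm w" by (simp add: K_def)
qed

text \<open>The counterpart for passing from tube coordinates \<open>v\<close> to relative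
  displacements \<open>s\<close>. The first-order part is \<open>v\<close> itself, whence the last
  bound.\<close>

lemma exp_vec_estimate:
  fixes v :: "complex ^ 'n"
  assumes v: "norm v \<le> 1"
  defines "s \<equiv> (\<chi> i. exp (v $ i) - 1)" and "K \<equiv> 8 * real CARD('n)"
  shows "norm (s - (v + (1 / 2) *\<^sub>R vec_prod v v)) \<le> K * norm v ^ 3"
    "norm (s - v) \<le> K * (norm v)\<^sup>2" "norm s \<le> K * norm v" "norm v \<le> K * norm v"
proof -
  let ?n = "norm v"
  have comp: "cmod (v $ i) \<le> ?n" for i by (rule Finite_Cartesian_Product.norm_nth_le)
  have pow: "cmod (v $ i) ^ k \<le> ?n ^ k" for i k by (rule power_mono[OF comp]) simp
  have n2: "?n\<^sup>2 \<le> ?n" and n3: "?n ^ 3 \<le> ?n\<^sup>2"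
    using mult_right_mono[OF v, of ?n] mult_right_mono[OF v, of "?n\<^sup>2"]
    by (simp_all add: power2_eq_square power3_eq_cube)
  have 1: "cmod (s $ i - (v $ i + (v $ i)\<^sup>2 / 2)) \<le> 3 * ?n ^ 3" for i
    using order_trans[OF exp_Taylor2[of "v $ i"] mult_left_mono[OF pow[of i 3]]] order_trans[OF comp[of i] v]
    by (simp add: s_def)
  have 2: "cmod (s $ i - v $ i) \<le> 4 * ?n\<^sup>2" for i
  proof -
    have "cmod (s $ i - v $ i) \<le> cmod (s $ i - (v $ i + (v $ i)\<^sup>2 / 2)) + cmod ((v $ i)\<^sup>2 / 2)"
      using norm_triangle_ineq[of "s $ i - (v $ i + (v $ i)\<^sup>2 / 2)" "(v $ i)\<^sup>2 / 2"] by simp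
    moreover have "cmod ((v $ i)\<^sup>2 / 2) \<le> ?n\<^sup>2 / 2" using pow[of i 2] by (simp only: norm_divide norm_power) simp
    ultimately show ?thesis using 1[of i] n3 zero_le_power2[of ?n] by linarith
  qed
  have 3: "cmod (s $ i) \<le> 5 * ?n" for i
    using 2[of i] n2 comp[of i] norm_triangle_ineq[of "s $ i - v $ i" "v $ i"] by simp
  have card: "real CARD('n) \<ge> 1" using zero_less_card_finite[where 'a = 'n] by linarith
  have "norm ((s - (v + (1 / 2) *\<^sub>R vec_prod v v)) $ i) \<le> 8 * ?n ^ 3" for i
    using order_trans[OF 1[of i] mult_right_mono[of 3 8 "?n ^ 3"]] by (simp add: vec_prod_def power2_eq_square scaleR_conv_of_real[where 'a = complex])
  from norm_vec_le_card[OF this]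
  show "norm (s - (v + (1 / 2) *\<^sub>R vec_prod v v)) \<le> K * norm v ^ 3" by (simp add: K_def)
  have "norm ((s - v) $ i) \<le> 8 * ?n\<^sup>2" for i using order_trans[OF 2[of i] mult_right_mono[of 4 8 "?n\<^sup>2"]] by simp
  from norm_vec_le_card[OF this] show "norm (s - v) \<le> K * (norm v)\<^sup>2" by (simp add: K_def)
  have "norm (s $ i) \<le> 8 * ?n" for i using 3[of i] norm_ge_zero[of v] by linarith
  from norm_vec_le_card[OF this] show "norm s \<le> K * norm v" by (simp add: K_def)
  have "1 \<le> K" using card unfolding K_def by linarith
  from mult_right_mono[OF this norm_ge_zero] show "norm v \<le> K * norm v" by simp
qed

section \<open>Logarithmic coordinates\<close>

lemma linear_bound:
  fixes f :: "'a::euclidean_space \<Rightarrow> 'b::real_normed_vector"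
  assumes "linear f"
  obtains K where "K > 0" "\<And>x. norm (f x) \<le> K * norm x"
  using bounded_linear.pos_bounded[of f] assms
  by (auto simp: linear_conv_bounded_linear mult.commute)

lemma continuous_on_linear_compose:
  fixes f :: "'a::euclidean_space \<Rightarrow> 'b::real_normed_vector"
  assumes "linear f" "continuous_on S g"
  shows "continuous_on S (\<lambda>x. f (g x))"
  using assms bounded_linear.continuous_on linear_conv_bounded_linear by blast

lemma continuous_on_ln_abs: "continuous_on {z. \<forall>i. z $ i \<noteq> 0} ln_abs"
  unfolding ln_abs_def by (intro continuous_intros) auto

lemma open_Omega:
  fixes V :: "(real ^ 'n) set"
  assumes "open V"
  shows "open (Omega V)"
proof -
  have "open {z :: complex ^ 'n. \<forall>i. z $ i \<noteq> 0}"
    unfolding Collect_all_eq by (intro open_INT ballI finite open_Collect_neq continuous_intros)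
  then have "open (ln_abs -` V \<inter> {z :: complex ^ 'n. \<forall>i. z $ i \<noteq> 0})"
    using continuous_on_open_vimage continuous_on_ln_abs assms by blast
  moreover have "Omega V = ln_abs -` V \<inter> {z. \<forall>i. z $ i \<noteq> 0}"
    unfolding Omega_def by auto
  ultimately show ?thesis by simp
qed

text \<open>A continuous section of \<open>ln_abs\<close>. It carries semicontinuity back to
  \<open>V\<close> and provides a base point over a given \<open>x0\<close>.\<close>

definition cexp :: "real ^ 'n \<Rightarrow> complex ^ 'n" where
  "cexp x = (\<chi> i. complex_of_real (exp (x $ i)))"

lemma cexp_nonzero [simp]: "cexp x $ i \<noteq> 0"
  by (simp add: cexp_def)

lemma ln_abs_cexp [simp]: "ln_abs (cexp x) = x"
  by (simp add: ln_abs_def cexp_def vec_eq_iff)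

lemma cexp_in_Omega: "x \<in> V \<Longrightarrow> cexp x \<in> Omega V"
  by (simp add: Omega_def)

lemma continuous_on_cexp: "continuous_on S cexp"
  unfolding cexp_def by (intro continuous_intros)

text \<open>For \<open>q\<close> at least the dimension both notions reduce to semicontinuity, so
  this settles that case.\<close>

lemma usc_on_Omega_iff:
  assumes "open V"
  shows "usc_on (Omega V) (\<lambda>z. u (ln_abs z)) \<longleftrightarrow> usc_on V u"
proof
  assume "usc_on (Omega V) (\<lambda>z. u (ln_abs z))"
  from usc_on_compose[OF this continuous_on_cexp[of V]] show "usc_on V u"
    by (simp add: image_subset_iff cexp_in_Omega)
next
  assume "usc_on V u"
  moreover have "continuous_on (Omega V) ln_abs"
    by (rule continuous_on_subset[OF continuous_on_ln_abs]) (auto simp: Omega_def)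
  ultimately show "usc_on (Omega V) (\<lambda>z. u (ln_abs z))"
    by (rule usc_on_compose) (auto simp: Omega_def)
qed

section \<open>Transport of touching functions through the logarithm\<close>

text \<open>The pluriharmonic \<open>h\<close> is the second-order Taylor polynomial of the test function composed with \<open>ln_abs\<close>, in
  the coordinates \<open>w\<close> with \<open>z = cexp x0 (1 + w)\<close>, except that \<open>B (Re w) (Re w)\<close> is replaced by
  its pluriharmonic part \<open>(B (Re w) (Re w) - B (Im w) (Im w)) / 2\<close>.\<close>

lemma not_plurisubharmonic_if_touching:
  fixes u :: "real ^ 'n \<Rightarrow> ereal" and L :: "(real ^ 'n) set"
  assumes V: "open V" "x0 \<in> V" and q: "q < CARD('n)" and \<alpha>: "u x0 = ereal \<alpha>"
    and L: "subspace L" "dim L = q + 1"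
    and \<Lambda>: "linear \<Lambda>" and B: "bilinear B" and sym: "\<And>x y. B x y = B y x"
    and \<delta>: "\<delta> > 0"
    and le: "\<And>t. norm t < \<delta> \<Longrightarrow> u (x0 + t) \<le> ereal (\<alpha> + \<Lambda> t + B t t)"
    and \<epsilon>: "\<epsilon> > 0" and neg: "\<And>t. t \<in> L \<Longrightarrow> B t t \<le> - \<epsilon> * (norm t)\<^sup>2"
  shows "\<not> q_plurisubharmonic_on q (Omega V) (\<lambda>z. u (ln_abs z))"
proof
  assume psh: "q_plurisubharmonic_on q (Omega V) (\<lambda>z. u (ln_abs z))"
  define z0 :: "complex ^ 'n" where "z0 = cexp x0"
  define W where "W = scale_by (\<lambda>i. inverse (z0 $ i))"
  have z0: "z0 $ i \<noteq> 0" for i by (simp add: z0_def)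
  \<comment> \<open>\<open>W\<close> takes displacements from \<open>z0\<close> to relative ones,
    and \<open>M\<close> is the complexification of \<open>L\<close> seen before that scaling.
    Negativity of \<open>B\<close> on \<open>L\<close> thus applies to both parts of
    \<open>W s\<close>.\<close>
  obtain M where M: "vec.subspace M" "vec.dim M = dim L" "\<And>s. s \<in> M \<Longrightarrow> Re_vec (W s) \<in> L \<and> Im_vec (W s) \<in> L"
    using complexified_subspace[OF L(1), of "\<lambda>i. inverse (z0 $ i)"] z0 unfolding W_def by auto
  have linW: "linear W" unfolding W_def by (rule linear_scale_by)
  obtain KW where KW: "KW > 0" "\<And>s. norm (W s) \<le> KW * norm s" using linear_bound[OF linW] by blast
  obtain KZ where KZ: "KZ > 0" "\<And>w. norm (scale_by (($) z0) w) \<le> KZ * norm w"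
    using linear_bound[OF linear_scale_by] by blast
  have WZ: "norm s \<le> KZ * norm (W s)" for s
    using KZ(2)[of "W s"] scale_by_inverse(2)[of "($) z0" s] z0 unfolding W_def by simp
  define K where "K = 8 * real CARD('n)"
  have K: "K > 0" by (simp add: K_def)
  obtain K' where K': "K' \<ge> 0" "\<And>s p d \<rho>. \<lbrakk>norm (s - p) \<le> K * \<rho> ^ 3; norm (s - d) \<le> K * \<rho>\<^sup>2; norm s \<le> K * \<rho>; norm d \<le> K * \<rho>; \<rho> \<ge> 0\<rbrakk>
       \<Longrightarrow> \<bar>\<Lambda> s + B s s - (\<Lambda> p + B d d)\<bar> \<le> K' * \<rho> ^ 3"
    using quadratic_perturbation[OF \<Lambda> B, of K] K by auto
  \<comment> \<open>The three bounds keep the logarithm estimate valid, the displacement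
    \<open>t\<close> within \<open>\<delta>\<close>, and the cubic error below \<epsilon>/4 times
    the squared norm of \<open>w\<close>.\<close>
  define w0 where "w0 = min (1 / 2) (min (\<delta> / (2 * K)) (\<epsilon> / (4 * (K' + 1))))"
  have w0: "w0 > 0" using \<delta> K \<epsilon> K'(1) by (simp add: w0_def)
  obtain \<rho>1 where \<rho>1: "\<rho>1 > 0" "cball z0 \<rho>1 \<subseteq> Omega V"
    using open_Omega[OF V(1)] cexp_in_Omega[OF V(2)] unfolding z0_def open_contains_cball by blast
  define \<rho> where "\<rho> = min \<rho>1 (w0 / KW)"
  have \<rho>: "\<rho> > 0" "cball z0 \<rho> \<subseteq> Omega V" using \<rho>1 w0 KW(1) by (auto simp: \<rho>_def)
  \<comment> \<open>A lower bound for the margin in \<open>est\<close> on the sphere of radius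
    \<open>\<rho>\<close>, where \<open>norm (W s)\<close> is at least \<open>\<rho> / KZ\<close>.
    Lowering \<open>h\<close> by \<open>\<kappa>\<close> keeps the boundary inequality and breaks it
    at \<open>z0\<close>.\<close>
  define \<kappa> where "\<kappa> = \<epsilon> / 4 * (\<rho> / KZ)\<^sup>2"
  have \<kappa>: "\<kappa> > 0" using \<epsilon> \<rho>(1) KZ(1) by (simp add: \<kappa>_def)
  define \<Gamma> where "\<Gamma> s s' = - (1 / 2) * \<Lambda> (Re_vec (vec_prod (W s) (W s')))
    + (1 / 2) * (B (Re_vec (W s)) (Re_vec (W s')) - B (Im_vec (W s)) (Im_vec (W s')))" for s s'
  define h where "h z = \<alpha> - \<kappa> + \<Lambda> (Re_vec (W (z - z0))) + \<Gamma> (z - z0) (z - z0)" for z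
  note lin = linear_add[OF linW] linear_scale[OF linW] linear_add[OF \<Lambda>] linear_scale[OF \<Lambda>]
    linear_add[OF linear_Re_vec] linear_scale[OF linear_Re_vec]
    linear_add[OF linear_Im_vec] linear_scale[OF linear_Im_vec] linear_neg[OF \<Lambda>] linear_neg[OF linear_Re_vec]
  note bil = bilinear_ladd[OF B] bilinear_radd[OF B] bilinear_lmul[OF B] bilinear_rmul[OF B]
     bilinear_lneg[OF B] bilinear_rneg[OF B]
  have Wi: "W (\<i> *s s) = \<i> *s W s" for s unfolding W_def by (rule scale_by_complex_linear)
  have pluri: "pluriharmonic_on UNIV h"
    unfolding h_def
  proof (rule pluriharmonic_quadratic[where \<Lambda> = "\<lambda>s. \<Lambda> (Re_vec (W s))" and \<Gamma> = \<Gamma>])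
    show "linear (\<lambda>s. \<Lambda> (Re_vec (W s)))" by (rule linearI) (simp_all add: lin)
    show "bilinear \<Gamma>"
      unfolding bilinear_def \<Gamma>_def
      by (intro conjI allI linearI) (simp_all add: lin bil vec_prod_bilinear algebra_simps)
    show "\<Gamma> v w = \<Gamma> w v" for v w
      unfolding \<Gamma>_def by (simp add: vec_prod_def mult.commute sym)
    show "\<Gamma> (\<i> *s v) (\<i> *s v) = - \<Gamma> v v" for v
      unfolding \<Gamma>_def by (simp add: Wi vec_prod_ii lin bil field_simps)
  qed
  \<comment> \<open>Passing to the pluriharmonic part of \<open>B\<close> leaves half of B (Re w)
    (Re w) + B (Im w) (Im w), at most -\<epsilon>/2 |w|^2; the cubic error takes back at most
    \<epsilon>/4 |w|^2.\<close>
  have est: "u (ln_abs (z0 + s)) \<le> ereal (h (z0 + s) + \<kappa> - \<epsilon> / 4 * (norm (W s))\<^sup>2)"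
    if s: "s \<in> M" "norm s \<le> \<rho>" for s
  proof -
    let ?w = "W s"
    have "norm ?w \<le> KW * \<rho>" using KW(1) s(2) by (intro order_trans[OF KW(2)] mult_left_mono) auto
    also have "\<dots> \<le> w0" using KW(1) by (simp add: \<rho>_def min_def field_simps)
    finally have w: "norm ?w \<le> w0" .
    then have half: "norm ?w \<le> 1 / 2" by (simp add: w0_def)
    define t where "t = (\<chi> i. ln (cmod (1 + ?w $ i)))"
    let ?p = "Re_vec (?w - (1 / 2) *\<^sub>R vec_prod ?w ?w)"
    note es = ln_vec_estimate[OF half, folded t_def K_def]
    have "ln_abs (z0 + s) = x0 + t"
    proof -
      have "ln (cmod ((z0 + s) $ i)) = x0 $ i + ln (cmod (1 + ?w $ i))" for i
      proof -
        have "(z0 + s) $ i = z0 $ i * (1 + ?w $ i)"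
          using z0[of i] by (simp add: W_def scale_by_def field_simps)
        moreover have "cmod (?w $ i) \<le> 1 / 2"
          using Finite_Cartesian_Product.norm_nth_le[of ?w i] half by linarith
        then have "?w $ i \<noteq> - 1" by auto
        then have "1 + ?w $ i \<noteq> 0" by (simp add: eq_neg_iff_add_eq_0 add.commute)
        ultimately show ?thesis
          using z0[of i] by (simp add: norm_mult ln_mult z0_def cexp_def)
      qed
      then show ?thesis by (simp add: ln_abs_def t_def vec_eq_iff)
    qed
    moreover have "norm t < \<delta>"
    proof -
      have "norm t \<le> K * w0" using w K by (intro order_trans[OF es(3)] mult_left_mono) auto
      also have "\<dots> \<le> K * (\<delta> / (2 * K))" using K by (intro mult_left_mono) (auto simp: w0_def)
      also have "\<dots> < \<delta>" using K \<delta> by simp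
      finally show ?thesis .
    qed
    ultimately have 1: "u (ln_abs (z0 + s)) \<le> ereal (\<alpha> + \<Lambda> t + B t t)" using le by simp
    have 2: "\<bar>\<Lambda> t + B t t - (\<Lambda> ?p + B (Re_vec ?w) (Re_vec ?w))\<bar> \<le> K' * norm ?w ^ 3"
      by (rule K'(2)[OF es norm_ge_zero])
    have "(K' + 1) * norm ?w \<le> (K' + 1) * (\<epsilon> / (4 * (K' + 1)))"
      using w K'(1) by (intro mult_left_mono) (auto simp: w0_def)
    also have "\<dots> = \<epsilon> / 4" using K'(1) by (simp add: field_simps)
    finally have "K' * norm ?w \<le> \<epsilon> / 4" using norm_ge_zero[of ?w] unfolding distrib_right by linarith
    from mult_right_mono[OF this, of "(norm ?w)\<^sup>2"]
    have 3: "K' * norm ?w ^ 3 \<le> \<epsilon> / 4 * (norm ?w)\<^sup>2" by (simp add: power2_eq_square power3_eq_cube mult.assoc)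
    have 4: "B (Re_vec ?w) (Re_vec ?w) + B (Im_vec ?w) (Im_vec ?w) \<le> - \<epsilon> * (norm ?w)\<^sup>2"
      using neg[of "Re_vec ?w"] neg[of "Im_vec ?w"] M(3)[OF s(1)]
      unfolding norm_Re_Im_vec[of ?w, symmetric] by (simp add: algebra_simps)
    have 5: "\<Lambda> ?p = \<Lambda> (Re_vec ?w) - (1 / 2) * \<Lambda> (Re_vec (vec_prod ?w ?w))"
      by (simp add: linear_diff[OF linear_Re_vec] linear_diff[OF \<Lambda>] lin)
    have "h (z0 + s) + \<kappa> = \<alpha> + \<Lambda> ?p + (1 / 2) * (B (Re_vec ?w) (Re_vec ?w) - B (Im_vec ?w) (Im_vec ?w))"
      unfolding h_def \<Gamma>_def 5 by simp
    moreover define X where "X = \<epsilon> * (norm ?w)\<^sup>2"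
    have "K' * norm ?w ^ 3 \<le> X / 4" "B (Re_vec ?w) (Re_vec ?w) + B (Im_vec ?w) (Im_vec ?w) \<le> - X"
      using 3 4 unfolding X_def by simp_all
    moreover have "\<epsilon> / 4 * (norm ?w)\<^sup>2 = X / 4" unfolding X_def by simp
    moreover have "a + l1 + l2 \<le> H - E" if "H = a + p + 1 / 2 * (br - bi)" "k \<le> x / 4" "br + bi \<le> - x"
      "E = x / 4" "l1 + l2 - (p + br) \<le> k" for H E a p br bi k x l1 l2 :: real
      using that by argo
    ultimately have "\<alpha> + \<Lambda> t + B t t \<le> h (z0 + s) + \<kappa> - \<epsilon> / 4 * (norm ?w)\<^sup>2"
      using abs_le_D1[OF 2] by blast
    with 1 show ?thesis by (meson ereal_less_eq(3) order_trans)
  qed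
  have "\<forall>z\<in>cball z0 \<rho> \<inter> (+) z0 ` M. u (ln_abs z) \<le> ereal (h z)"
  proof -
    have "complex_affine_subspace (q + 1) ((+) z0 ` M)"
      unfolding complex_affine_subspace_def using M(1,2) L(2) by auto
    moreover have "\<forall>z\<in>sphere z0 \<rho> \<inter> (+) z0 ` M. u (ln_abs z) \<le> ereal (h z)"
    proof
      fix z assume "z \<in> sphere z0 \<rho> \<inter> (+) z0 ` M"
      then obtain s where s: "z = z0 + s" "s \<in> M" "norm s = \<rho>" by (auto simp: dist_norm)
      have "\<rho> / KZ \<le> norm (W s)" using WZ[of s] s(3) KZ(1) by (simp add: field_simps)
      then have "(\<rho> / KZ)\<^sup>2 \<le> (norm (W s))\<^sup>2" using \<rho>(1) KZ(1) by (intro power_mono) auto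
      then have "\<kappa> \<le> \<epsilon> / 4 * (norm (W s))\<^sup>2" unfolding \<kappa>_def using \<epsilon> by (intro mult_left_mono) auto
      then have "h z + \<kappa> - \<epsilon> / 4 * (norm (W s))\<^sup>2 \<le> h z" by simp
      then show "u (ln_abs z) \<le> ereal (h z)"
        using est[OF s(2)] s(1,3) by (meson ereal_less_eq(3) order_refl order_trans)
    qed
    ultimately show ?thesis
      using psh q \<rho> pluri unfolding q_plurisubharmonic_on_def by (meson open_UNIV subset_UNIV)
  qed
  moreover have "z0 \<in> cball z0 \<rho> \<inter> (+) z0 ` M"
    using \<rho>(1) vec.subspace_0[OF M(1)] by (auto intro: image_eqI[of _ _ 0])
  ultimately have "u (ln_abs z0) \<le> ereal (h z0)" by blast
  moreover have "h z0 = \<alpha> - \<kappa>"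
    by (simp add: h_def \<Gamma>_def linear_0[OF linW] linear_0[OF linear_Re_vec] linear_0[OF linear_Im_vec] linear_0[OF \<Lambda>]
        bilinear_lzero[OF B] vec_prod_def Re_vec_def vec_eq_iff zero_vec_def[symmetric])
  ultimately show False using \<kappa> \<alpha> by (simp add: z0_def)
qed

text \<open>In the tube coordinates \<open>v\<close> the test function is nonnegative to second order on \<open>\<i> \<real>\<^sup>n\<close>, since \<open>u\<close> does
  not depend on \<open>Im v\<close>. Hence \<open>Re\<close> is injective on a real subspace \<open>N\<close> where it is negative definite,
  and \<open>u\<close> violates convexity on \<open>x0 + Re N\<close>.\<close>

lemma not_convex_if_touching:
  fixes u :: "real ^ 'n \<Rightarrow> ereal" and M :: "(complex ^ 'n) set"
  assumes V: "open V" "x0 \<in> V" and q: "q < CARD('n)" and \<alpha>: "u x0 = ereal \<alpha>"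
    and M: "vec.subspace M" "vec.dim M = q + 1"
    and \<Lambda>: "linear \<Lambda>" and Q: "bilinear Q" and \<delta>: "\<delta> > 0"
    and le: "\<And>v. norm v < \<delta> \<Longrightarrow> u (x0 + Re_vec v) \<le> ereal (\<alpha> + \<Lambda> v + Q v v)"
    and neg: "\<And>v. v \<in> M \<Longrightarrow> v \<noteq> 0 \<Longrightarrow> Q v v + Q (\<i> *s v) (\<i> *s v) < 0"
  shows "\<not> real_q_convex_on q V u"
proof
  assume cvx: "real_q_convex_on q V u"
  obtain N where N: "subspace N" "N \<subseteq> M" "dim N = q + 1" "\<And>v. v \<in> N \<Longrightarrow> v \<noteq> 0 \<Longrightarrow> Q v v < 0"
    using real_negative_subspace[OF M(1) Q neg, of "q + 1"] M(2) by auto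
  \<comment> \<open>Imaginary directions leave the argument of \<open>u\<close> fixed, so the
    touching polynomial is at least \<open>\<alpha>\<close> on them; adding its values at opposite
    points removes the linear term.\<close>
  have imag: "Q v v \<ge> 0" if v: "Re_vec v = 0" for v
  proof -
    have "0 < \<delta> * norm v + \<delta> * 2" using \<delta> by (intro add_nonneg_pos) auto
    then obtain \<tau> where \<tau>: "\<tau> > 0" "\<tau> * norm v < \<delta>"
      using \<delta> by (intro that[of "\<delta> / (2 * (norm v + 1))"]) (auto simp: field_simps add_pos_nonneg)
    have "0 \<le> r * \<Lambda> v + r\<^sup>2 * Q v v" if "\<bar>r\<bar> = \<tau>" for r
      using le[of "r *\<^sub>R v"] that \<tau>(2) v \<alpha>
      by (simp add: linear_scale[OF linear_Re_vec] linear_scale[OF \<Lambda>] bilinear_lmul[OF Q] bilinear_rmul[OF Q]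
          power2_eq_square mult.assoc)
    from this[of \<tau>] this[of "- \<tau>"] have "0 \<le> \<tau>\<^sup>2 * Q v v"
      using \<tau>(1) unfolding power2_minus mult_minus_left by linarith
    then show ?thesis using \<tau>(1) by (simp add: zero_le_mult_iff)
  qed
  have inj: "inj_on Re_vec N"
    unfolding linear_inj_on_iff_eq_0[OF linear_Re_vec N(1)] using imag N(4) by (meson not_less)
  define R where "R = Re_vec ` N"
  have R: "subspace R" unfolding R_def by (rule linear_subspace_image[OF linear_Re_vec N(1)])
  have dimR: "dim R = q + 1"
    unfolding R_def using dim_image_eq[OF linear_Re_vec, of N] inj N(1,3) by (simp add: span_eq_iff[THEN iffD2])
  \<comment> \<open>Composing with the inverse \<open>\<sigma>\<close> of \<open>Re_vec\<close> on
    \<open>N\<close> makes the touching inequality one on \<open>x0 + R\<close>, with the negative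
    definite quadratic term \<open>Q (\<sigma> x) (\<sigma> x)\<close>.\<close>
  obtain \<sigma> where \<sigma>: "linear \<sigma>" "range \<sigma> \<subseteq> N" "\<And>v. v \<in> N \<Longrightarrow> \<sigma> (Re_vec v) = v"
    using linear_exists_left_inverse_on[OF linear_Re_vec N(1) inj] by blast
  have Re\<sigma>: "Re_vec (\<sigma> x) = x" if "x \<in> R" for x using that \<sigma>(3) unfolding R_def by auto
  obtain K\<sigma> where K\<sigma>: "K\<sigma> > 0" "\<And>x. norm (\<sigma> x) \<le> K\<sigma> * norm x" using linear_bound[OF \<sigma>(1)] by blast
  obtain \<rho>1 where \<rho>1: "\<rho>1 > 0" "cball x0 \<rho>1 \<subseteq> V"
    using V unfolding open_contains_cball by blast
  define \<rho> where "\<rho> = min \<rho>1 (\<delta> / (2 * K\<sigma>))"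
  have \<rho>: "\<rho> > 0" "cball x0 \<rho> \<subseteq> V" using \<rho>1 \<delta> K\<sigma>(1) by (auto simp: \<rho>_def)
  have \<sigma>small: "norm (\<sigma> x) < \<delta>" if "norm x \<le> \<rho>" for x
  proof -
    have "norm (\<sigma> x) \<le> K\<sigma> * (\<delta> / (2 * K\<sigma>))"
      using that K\<sigma>(1) by (intro order_trans[OF K\<sigma>(2)] mult_left_mono) (auto simp: \<rho>_def)
    also have "\<dots> < \<delta>" using K\<sigma>(1) \<delta> by simp
    finally show ?thesis .
  qed
  define S where "S = sphere 0 \<rho> \<inter> R"
  \<comment> \<open>By compactness the quadratic term gains a uniform \<open>\<kappa>\<close> on the
    sphere. The affine part lowered by \<open>\<kappa>\<close> still majorizes \<open>u\<close>
    there but lies below \<open>u\<close> at \<open>x0\<close>.\<close>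
  have "\<exists>\<kappa>>0. \<forall>x\<in>S. Q (\<sigma> x) (\<sigma> x) \<le> - \<kappa>"
  proof (cases "S = {}")
    case True
    then show ?thesis by (auto intro: exI[of _ 1])
  next
    case False
    have "compact S" unfolding S_def by (intro compact_Int_closed compact_sphere closed_subspace R)
    moreover have "continuous_on S (\<lambda>x. Q (\<sigma> x) (\<sigma> x))"
      using Q by (intro bounded_bilinear.continuous_on[of Q] continuous_on_linear_compose[OF \<sigma>(1)] continuous_on_id)
        (simp_all add: bilinear_conv_bounded_bilinear)
    ultimately obtain m where m: "m \<in> S" "\<forall>x\<in>S. Q (\<sigma> x) (\<sigma> x) \<le> Q (\<sigma> m) (\<sigma> m)"
      using continuous_attains_sup False by blast
    have "m \<noteq> 0" "m \<in> R" using m(1) \<rho>(1) unfolding S_def by auto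
    then have "\<sigma> m \<noteq> 0" using Re\<sigma>[of m] linear_0[OF linear_Re_vec] by metis
    then have "Q (\<sigma> m) (\<sigma> m) < 0" using N(4) \<sigma>(2) by blast
    then show ?thesis using m(2) by (intro exI[of _ "- Q (\<sigma> m) (\<sigma> m)"]) auto
  qed
  then obtain \<kappa> where \<kappa>: "\<kappa> > 0" "\<And>x. x \<in> S \<Longrightarrow> Q (\<sigma> x) (\<sigma> x) \<le> - \<kappa>" by blast
  define P where "P = (+) x0 ` R"
  define l where "l y = \<alpha> + \<Lambda> (\<sigma> (y - x0)) - \<kappa>" for y
  have "affine P" unfolding P_def using subspace_imp_affine[OF R] affine_translation[of R x0] by simp
  moreover have "aff_dim P = int (q + 1)"
    unfolding P_def aff_dim_translation_eq using aff_dim_subspace[OF R] dimR by simp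
  moreover have "affine_fun_on P l"
    unfolding affine_fun_on_def
  proof (intro ballI allI impI)
    fix x y and s t :: real assume st: "s + t = 1"
    have "s *\<^sub>R x + t *\<^sub>R y - x0 = s *\<^sub>R x + t *\<^sub>R y - (s + t) *\<^sub>R x0" using st by simp
    also have "\<dots> = s *\<^sub>R (x - x0) + t *\<^sub>R (y - x0)" by (simp add: algebra_simps)
    finally have "\<Lambda> (\<sigma> (s *\<^sub>R x + t *\<^sub>R y - x0)) = s * \<Lambda> (\<sigma> (x - x0)) + t * \<Lambda> (\<sigma> (y - x0))"
      by (simp add: linear_add[OF \<sigma>(1)] linear_scale[OF \<sigma>(1)] linear_add[OF \<Lambda>] linear_scale[OF \<Lambda>])
    moreover have "\<alpha> - \<kappa> = s * (\<alpha> - \<kappa>) + t * (\<alpha> - \<kappa>)" using st by (metis distrib_right mult_1)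
    ultimately show "l (s *\<^sub>R x + t *\<^sub>R y) = s * l x + t * l y"
      unfolding l_def by (simp add: algebra_simps)
  qed
  moreover have "\<forall>x\<in>sphere x0 \<rho> \<inter> P. u x \<le> ereal (l x)"
  proof
    fix y assume "y \<in> sphere x0 \<rho> \<inter> P"
    then obtain x where x: "y = x0 + x" "x \<in> R" "norm x = \<rho>" unfolding P_def by (auto simp: dist_norm)
    have "u y \<le> ereal (\<alpha> + \<Lambda> (\<sigma> x) + Q (\<sigma> x) (\<sigma> x))"
      using le[OF \<sigma>small[of x]] Re\<sigma>[OF x(2)] x by simp
    also have "\<dots> \<le> ereal (l y)" using \<kappa>(2)[of x] x by (simp add: l_def S_def)
    finally show "u y \<le> ereal (l y)" .
  qed
  ultimately have "\<forall>x\<in>cball x0 \<rho> \<inter> P. u x \<le> ereal (l x)"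
    using cvx q \<rho> unfolding real_q_convex_on_def by blast
  moreover have "x0 \<in> cball x0 \<rho> \<inter> P"
    using \<rho>(1) subspace_0[OF R] unfolding P_def by (auto intro: image_eqI[of _ _ 0])
  ultimately have "u x0 \<le> ereal (l x0)" by blast
  then show False using \<alpha> \<kappa>(1) by (simp add: l_def linear_0[OF \<sigma>(1)] linear_0[OF \<Lambda>])
qed

section \<open>From violations to touching functions: the two implications\<close>

text \<open>\<open>affine_fun_on\<close> constrains \<open>l\<close> on \<open>P\<close> only, while
  \<open>penalized_max\<close> takes a majorant on the whole ball. The retraction
  \<open>v - T v\<close> extends the linear part.\<close>

lemma affine_fun_on_linear_part:
  fixes l :: "'a::euclidean_space \<Rightarrow> real"
  assumes P: "affine P" "y \<in> P" and l: "affine_fun_on P l"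
  obtains G where "linear G" "\<And>x. x \<in> P \<Longrightarrow> l x = l y + G (x - y)"
proof -
  define L where "L = (\<lambda>x. x - y) ` P"
  have L: "subspace L" unfolding L_def by (rule affine_diffs_subspace_subtract[OF P])
  have yL: "y + v \<in> P" if "v \<in> L" for v using that unfolding L_def by auto
  obtain T where T: "linear T" "\<And>v. T v = 0 \<longleftrightarrow> v \<in> L" "\<And>v. v - T v \<in> L"
    using projection_onto_subspace[OF L] by blast
  define m where "m v = l (y + v) - l y" for v
  have m_scale: "m (k *\<^sub>R v) = k * m v" if "v \<in> L" for k v
  proof -
    have "k *\<^sub>R (y + v) + (1 - k) *\<^sub>R y = y + k *\<^sub>R v" by (simp add: algebra_simps)
    moreover have "l (k *\<^sub>R (y + v) + (1 - k) *\<^sub>R y) = k * l (y + v) + (1 - k) * l y"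
      using l P(2) yL[OF that] unfolding affine_fun_on_def by simp
    ultimately show ?thesis unfolding m_def by (simp add: algebra_simps)
  qed
  \<comment> \<open>y + v + w is the midpoint of y + 2v and y + 2w, and homogeneity removes the
    factors.\<close>
  have m_add: "m (v + w) = m v + m w" if "v \<in> L" "w \<in> L" for v w
  proof -
    have "(1 / 2) *\<^sub>R (y + 2 *\<^sub>R v) + (1 / 2) *\<^sub>R (y + 2 *\<^sub>R w) = (1 / 2 + 1 / 2) *\<^sub>R y + (v + w)"
      unfolding scaleR_add_left scaleR_add_right by simp
    then have "(1 / 2) *\<^sub>R (y + 2 *\<^sub>R v) + (1 / 2) *\<^sub>R (y + 2 *\<^sub>R w) = y + (v + w)" by simp
    moreover have "l ((1 / 2) *\<^sub>R (y + 2 *\<^sub>R v) + (1 / 2) *\<^sub>R (y + 2 *\<^sub>R w)) = 1 / 2 * l (y + 2 *\<^sub>R v) + 1 / 2 * l (y + 2 *\<^sub>R w)"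
      using l yL subspace_scale[OF L] that unfolding affine_fun_on_def by (meson field_sum_of_halves)
    ultimately have "m (v + w) = 1 / 2 * m (2 *\<^sub>R v) + 1 / 2 * m (2 *\<^sub>R w)" unfolding m_def by (simp add: field_simps)
    then show ?thesis using m_scale that by simp
  qed
  show ?thesis
  proof (rule that)
    show "linear (\<lambda>v. m (v - T v))"
    proof (rule linearI)
      fix v w
      have "v + w - T (v + w) = (v - T v) + (w - T w)" by (simp add: linear_add[OF T(1)])
      then show "m (v + w - T (v + w)) = m (v - T v) + m (w - T w)" using m_add T(3) by metis
    next
      fix k v
      have "k *\<^sub>R v - T (k *\<^sub>R v) = k *\<^sub>R (v - T v)" by (simp add: linear_scale[OF T(1)] scaleR_diff_right)
      then show "m (k *\<^sub>R v - T (k *\<^sub>R v)) = k *\<^sub>R m (v - T v)" using m_scale T(3) by (metis real_scaleR_def)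
    qed
    fix x assume "x \<in> P"
    then have "T (x - y) = 0" using T(2) unfolding L_def by blast
    then show "l x = l y + m (x - y - T (x - y))" by (simp add: m_def)
  qed
qed

text \<open>The penalties are quadratic polynomials, so their increment from \<open>x0\<close> is
  exactly a linear term plus a quadratic form.\<close>

lemma penalty_expansion:
  fixes T :: "'a::euclidean_space \<Rightarrow> 'a"
  assumes T: "linear T"
  shows "- \<epsilon> * (norm (x0 + t - c))\<^sup>2 + M * (norm (T (x0 + t - a)))\<^sup>2
       - (- \<epsilon> * (norm (x0 - c))\<^sup>2 + M * (norm (T (x0 - a)))\<^sup>2)
     = (2 * M * (T t \<bullet> T (x0 - a)) - 2 * \<epsilon> * (t \<bullet> (x0 - c))) + (M * (T t \<bullet> T t) - \<epsilon> * (t \<bullet> t))"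
proof -
  have "x0 + t - c = (x0 - c) + t" "T (x0 + t - a) = T (x0 - a) + T t"
    by (simp_all add: linear_add[OF T, symmetric] algebra_simps)
  then show ?thesis
    by (simp only: power2_norm_eq_inner inner_add_left inner_add_right)
      (simp add: inner_commute algebra_simps)
qed

text \<open>Along the directions of \<open>P\<close> the distance penalty vanishes and the affine
  majorant has no second-order part, so -\<epsilon> |t|^2 is all that remains of the touching
  polynomial's quadratic form.\<close>

lemma real_q_convex_if_plurisubharmonic:
  fixes u :: "real ^ 'n \<Rightarrow> ereal"
  assumes V: "open V" and psh: "q_plurisubharmonic_on q (Omega V) (\<lambda>z. u (ln_abs z))"
  shows "real_q_convex_on q V u"
  unfolding real_q_convex_on_def
proof (intro conjI impI allI ballI)
  show usc: "usc_on V u"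
    using psh usc_on_Omega_iff[OF V] unfolding q_plurisubharmonic_on_def by blast
  fix P c r l y
  assume q: "q < CARD('n)"
    and A: "affine P \<and> aff_dim P = int (q + 1) \<and> r > 0 \<and> cball c r \<subseteq> V \<and> affine_fun_on P l \<and>
          (\<forall>x \<in> sphere c r \<inter> P. u x \<le> ereal (l x))"
    and y: "y \<in> cball c r \<inter> P"
  show "u y \<le> ereal (l y)"
  proof (rule ccontr)
    assume viol: "\<not> u y \<le> ereal (l y)"
    define L where "L = (\<lambda>x. x - y) ` P"
    have L: "subspace L" unfolding L_def using A y by (intro affine_diffs_subspace_subtract) auto
    have dimL: "dim L = q + 1"
      using aff_dim_subspace[OF L] aff_dim_translation_eq_subtract[of y P] A unfolding L_def by simp
    obtain T where T: "linear T" "\<And>v. T v = 0 \<longleftrightarrow> v \<in> L" "\<And>v. v - T v \<in> L"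
      using projection_onto_subspace[OF L] by blast
    obtain G where G: "linear G" "\<And>x. x \<in> P \<Longrightarrow> l x = l y + G (x - y)"
      using affine_fun_on_linear_part[of P y l] A y by blast
    define g where "g x = (norm (T (x - y)))\<^sup>2" for x
    have g0: "x \<in> P" if "g x = 0" for x
      using that T(2)[of "x - y"] unfolding g_def L_def by auto
    have cont_lin: "continuous_on S (\<lambda>x. G (x - y))" "continuous_on S (\<lambda>x. T (x - y))" for S
      by (rule continuous_on_linear_compose[OF G(1)] continuous_on_linear_compose[OF T(1)], intro continuous_intros)+
    have cont: "continuous_on S (\<lambda>x. l y + G (x - y))" "continuous_on S g" for S
      unfolding g_def by (intro continuous_intros cont_lin)+
    obtain \<epsilon> M x0 \<alpha> where pm: "\<epsilon> > 0" "x0 \<in> ball c r" "u x0 = ereal \<alpha>"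
      "\<And>x. x \<in> cball c r \<Longrightarrow> u x \<le> ereal (\<alpha> + (l y + G (x - y) - \<epsilon> * (norm (x - c))\<^sup>2 + M * g x)
         - (l y + G (x0 - y) - \<epsilon> * (norm (x0 - c))\<^sup>2 + M * g x0))"
    proof (rule penalized_max[of c r u "\<lambda>x. l y + G (x - y)" g y])
      show "usc_on (cball c r) u" using usc_on_subset[OF usc] A by blast
      show "u x \<le> ereal (l y + G (x - y))" if "x \<in> sphere c r" "g x = 0" for x
        using A g0[OF that(2)] that(1) G(2) by simp
      show "\<not> u y \<le> ereal (l y + G (y - y))" using viol by (simp add: linear_0[OF G(1)])
    qed (use A y cont linear_0[OF T(1)] in \<open>auto simp: g_def\<close>)
    obtain \<delta> where \<delta>: "\<delta> > 0" "ball x0 \<delta> \<subseteq> ball c r"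
      using pm(2) open_contains_ball open_ball by blast
    define \<Lambda> where "\<Lambda> t = G t + (2 * M * (T t \<bullet> T (x0 - y)) - 2 * \<epsilon> * (t \<bullet> (x0 - c)))" for t
    define B where "B s t = M * (T s \<bullet> T t) - \<epsilon> * (s \<bullet> t)" for s t
    have "\<not> q_plurisubharmonic_on q (Omega V) (\<lambda>z. u (ln_abs z))"
    proof (rule not_plurisubharmonic_if_touching[where u = u and \<Lambda> = \<Lambda> and B = B, OF V _ q pm(3) L dimL _ _ _ \<delta>(1) _ pm(1)])
      show "x0 \<in> V" using pm(2) A by auto
      show "linear \<Lambda>"
        by (rule linearI) (simp_all add: \<Lambda>_def linear_add[OF G(1)] linear_scale[OF G(1)] linear_add[OF T(1)]
            linear_scale[OF T(1)] inner_add_left algebra_simps)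
      show "bilinear B"
        unfolding bilinear_def B_def
        by (intro conjI allI linearI) (simp_all add: linear_add[OF T(1)]
            linear_scale[OF T(1)] inner_add_left inner_add_right algebra_simps)
      show "B s t = B t s" for s t by (simp add: B_def inner_commute)
      show "B t t \<le> - \<epsilon> * (norm t)\<^sup>2" if "t \<in> L" for t
      proof -
        have "T t = 0" using T(2) that by blast
        then show ?thesis by (simp add: B_def power2_norm_eq_inner)
      qed
      fix t :: "real ^ 'n" assume "norm t < \<delta>"
      then have "x0 + t \<in> ball x0 \<delta>" by (simp add: dist_norm)
      then have "x0 + t \<in> cball c r" using \<delta>(2) by (meson ball_subset_cball subsetD)
      from pm(4)[OF this] show "u (x0 + t) \<le> ereal (\<alpha> + \<Lambda> t + B t t)"
      proof (rule order_trans)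
        have "G (x0 + t - y) = G (x0 - y) + G t"
          by (simp add: linear_add[OF G(1), symmetric] algebra_simps)
        then show "ereal (\<alpha> + (l y + G (x0 + t - y) - \<epsilon> * (norm (x0 + t - c))\<^sup>2 + M * g (x0 + t))
         - (l y + G (x0 - y) - \<epsilon> * (norm (x0 - c))\<^sup>2 + M * g x0)) \<le> ereal (\<alpha> + \<Lambda> t + B t t)"
          using penalty_expansion[OF T(1), of \<epsilon> x0 t c M y] unfolding \<Lambda>_def B_def g_def ereal_less_eq by linarith
      qed
    qed
    with psh show False by blast
  qed
qed

lemma norm_ii_scale: "norm (\<i> *s (v :: complex ^ 'n)) = norm v"
  by (simp add: norm_vec_def norm_mult)

text \<open>The majorant \<open>h\<close> has a Hessian of its own, so only the Levi form of the
  touching function is known to be negative along \<open>P\<close>. This is why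
  \<open>not_convex_if_touching\<close> assumes a bound on the sum over \<open>v\<close> and
  \<open>\<i> *s v\<close>.\<close>

lemma plurisubharmonic_if_real_q_convex:
  fixes u :: "real ^ 'n \<Rightarrow> ereal"
  assumes V: "open V" and cvx: "real_q_convex_on q V u"
  shows "q_plurisubharmonic_on q (Omega V) (\<lambda>z. u (ln_abs z))"
  unfolding q_plurisubharmonic_on_def
proof (intro conjI impI allI ballI)
  show usc: "usc_on (Omega V) (\<lambda>z. u (ln_abs z))"
    using cvx usc_on_Omega_iff[OF V] unfolding real_q_convex_on_def by blast
  fix P c r U h y
  assume q: "q < CARD('n)"
    and A: "complex_affine_subspace (q + 1) P \<and> r > 0 \<and> cball c r \<subseteq> Omega V \<and>
          open U \<and> cball c r \<subseteq> U \<and> pluriharmonic_on U h \<and>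
          (\<forall>z \<in> sphere c r \<inter> P. u (ln_abs z) \<le> ereal (h z))"
    and y: "y \<in> cball c r \<inter> P"
  obtain a L where L: "vec.subspace L" "vec.dim L = q + 1" "P = (+) a ` L"
    using A unfolding complex_affine_subspace_def by blast
  obtain h' h'' where C2: "C2_on_with U h h' h''"
    using A unfolding pluriharmonic_on_def by blast
  have pluri: "h'' z b b + h'' z (\<i> *s b) (\<i> *s b) = 0" if "z \<in> U" for z b
    using pluriharmonic_on_iff[OF _ C2] A that by blast
  show "u (ln_abs y) \<le> ereal (h y)"
  proof (rule ccontr)
    assume viol: "\<not> u (ln_abs y) \<le> ereal (h y)"
    obtain T where T: "linear T" "\<And>v. T v = 0 \<longleftrightarrow> v \<in> L" "\<And>v. v - T v \<in> L"
      using projection_onto_subspace[OF vec_subspace_imp_subspace[OF L(1)]] by blast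
    define g where "g z = (norm (T (z - a)))\<^sup>2" for z
    have g0: "g z = 0 \<longleftrightarrow> z \<in> P" for z
    proof -
      have "z \<in> P \<longleftrightarrow> z - a \<in> L"
      proof
        assume "z - a \<in> L"
        then show "z \<in> P" unfolding L(3) by (rule image_eqI[rotated]) simp
      qed (auto simp: L(3))
      then show ?thesis unfolding g_def using T(2)[of "z - a"] by simp
    qed
    have "continuous_on U h"
      using C2 has_derivative_continuous unfolding C2_on_with_def
      by (intro continuous_at_imp_continuous_on ballI) blast
    then have cont: "continuous_on (cball c r) h" using A continuous_on_subset by blast
    have cont_g: "continuous_on (cball c r) g"
      unfolding g_def
      by (intro continuous_intros continuous_on_linear_compose[OF T(1), where g = "\<lambda>z. z - a"])
    obtain \<epsilon> M z0 \<alpha> where pm: "\<epsilon> > 0" "z0 \<in> ball c r" "u (ln_abs z0) = ereal \<alpha>"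
      "\<And>z. z \<in> cball c r \<Longrightarrow> u (ln_abs z) \<le> ereal (\<alpha> + (h z - \<epsilon> * (norm (z - c))\<^sup>2 + M * g z)
         - (h z0 - \<epsilon> * (norm (z0 - c))\<^sup>2 + M * g z0))"
    proof (rule penalized_max[of c r "\<lambda>z. u (ln_abs z)" h g y])
      show "usc_on (cball c r) (\<lambda>z. u (ln_abs z))" using usc_on_subset[OF usc] A by blast
      show "u (ln_abs z) \<le> ereal (h z)" if "z \<in> sphere c r" "g z = 0" for z
        using A g0 that by blast
      show "r > 0" "y \<in> cball c r" "g y = 0" using A y g0 by blast+
      show "g z \<ge> 0" for z by (simp add: g_def)
      show "continuous_on (cball c r) h" "continuous_on (cball c r) g" "\<not> u (ln_abs y) \<le> ereal (h y)"
        by (fact cont cont_g viol)+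
    qed (rule that)
    have z0: "z0 \<in> Omega V" "z0 \<in> U" "z0 \<in> cball c r" using pm(2) A by auto
    define x0 where "x0 = ln_abs z0"
    have x0: "x0 \<in> V" and nz: "z0 $ i \<noteq> 0" for i using z0(1) unfolding Omega_def x0_def by auto
    obtain \<delta>1 where \<delta>1: "\<delta>1 > 0" "ball z0 \<delta>1 \<subseteq> ball c r"
      using pm(2) open_contains_ball open_ball by blast
    \<comment> \<open>Half of \<open>\<epsilon>\<close> pays for the Taylor remainder of
      \<open>h\<close>; the other half stays in \<open>C\<close>.\<close>
    obtain \<delta>2 where \<delta>2: "\<delta>2 > 0"
      "\<And>s. norm s < \<delta>2 \<Longrightarrow> \<bar>h (z0 + s) - h z0 - h' z0 s - h'' z0 s s / 2\<bar> \<le> \<epsilon> / 2 * (norm s)\<^sup>2"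
      using taylor2_little_o[OF _ z0(2) C2, of "\<epsilon> / 2"] A pm(1) by auto
    define \<Lambda> where "\<Lambda> s = h' z0 s + (2 * M * (T s \<bullet> T (z0 - a)) - 2 * \<epsilon> * (s \<bullet> (z0 - c)))" for s
    define C where "C s t = h'' z0 s t / 2 + M * (T s \<bullet> T t) - \<epsilon> / 2 * (s \<bullet> t)" for s t
    note lin = linear_add[OF T(1)] linear_scale[OF T(1)] blinfun.bilinear_simps inner_add_left inner_add_right
    have \<Lambda>: "linear \<Lambda>" by (rule linearI) (simp_all add: \<Lambda>_def lin algebra_simps)
    have C: "bilinear C"
      unfolding bilinear_def C_def by (intro conjI allI linearI) (simp_all add: lin field_simps)
    have touch: "u (ln_abs (z0 + s)) \<le> ereal (\<alpha> + \<Lambda> s + C s s)" if s: "norm s < \<delta>1" "norm s < \<delta>2" for s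
    proof -
      have "z0 + s \<in> ball z0 \<delta>1" using s(1) by (simp add: dist_norm)
      then have "z0 + s \<in> cball c r" using \<delta>1(2) by (meson ball_subset_cball subsetD)
      from pm(4)[OF this] show ?thesis
      proof (rule order_trans)
        have "h (z0 + s) - h z0 \<le> h' z0 s + h'' z0 s s / 2 + \<epsilon> / 2 * (norm s)\<^sup>2"
          using abs_le_D1[OF \<delta>2(2)[OF s(2)]] by linarith
        then show "ereal (\<alpha> + (h (z0 + s) - \<epsilon> * (norm (z0 + s - c))\<^sup>2 + M * g (z0 + s))
         - (h z0 - \<epsilon> * (norm (z0 - c))\<^sup>2 + M * g z0)) \<le> ereal (\<alpha> + \<Lambda> s + C s s)"
          using penalty_expansion[OF T(1), of \<epsilon> z0 s c M a]
          unfolding \<Lambda>_def C_def g_def ereal_less_eq power2_norm_eq_inner by (simp add: algebra_simps)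
      qed
    qed
    \<comment> \<open>\<open>h\<close> drops out by pluriharmonicity, and the distance penalty
      because \<open>L\<close> is invariant under \<i>.\<close>
    have levi: "C s s + C (\<i> *s s) (\<i> *s s) = - \<epsilon> * (norm s)\<^sup>2" if "s \<in> L" for s
    proof -
      have "T s = 0" "T (\<i> *s s) = 0" using T(2) that vec.subspace_scale[OF L(1)] by auto
      moreover have "(\<i> *s s) \<bullet> (\<i> *s s) = s \<bullet> s"
        using norm_ii_scale[of s] by (simp add: norm_eq)
      ultimately show ?thesis
        using pluri[OF z0(2), of s] unfolding C_def power2_norm_eq_inner by (simp add: field_simps)
    qed
    define Z where "Z = scale_by (($) z0)"
    have Z: "linear Z" unfolding Z_def by (rule linear_scale_by)
    define Z' where "Z' = scale_by (\<lambda>i. inverse (z0 $ i))"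
    have ZZ': "Z (Z' v) = v" "Z' (Z v) = v" for v
      unfolding Z_def Z'_def using scale_by_inverse[of "($) z0"] nz by auto
    obtain KZ where KZ: "KZ > 0" "\<And>v. norm (Z v) \<le> KZ * norm v" using linear_bound[OF Z] by blast
    obtain KI where KI: "KI > 0" "\<And>v. norm (Z' v) \<le> KI * norm v"
      using linear_bound[OF linear_scale_by] unfolding Z'_def by blast
    define K where "K = 8 * real CARD('n)"
    have K: "K > 0" by (simp add: K_def)
    define \<Lambda>1 where "\<Lambda>1 v = \<Lambda> (Z v)" for v
    define C1 where "C1 v w = C (Z v) (Z w)" for v w
    have \<Lambda>1: "linear \<Lambda>1"
      by (rule linearI) (simp_all add: \<Lambda>1_def linear_add[OF \<Lambda>] linear_add[OF Z] linear_scale[OF \<Lambda>] linear_scale[OF Z])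
    note bilC = bilinear_ladd[OF C] bilinear_radd[OF C] bilinear_lmul[OF C] bilinear_rmul[OF C]
    have C1: "bilinear C1"
      unfolding bilinear_def C1_def
      by (intro conjI allI linearI) (simp_all add: linear_add[OF Z] linear_scale[OF Z] bilC)
    obtain K' where K': "K' \<ge> 0" "\<And>s p d \<rho>. \<lbrakk>norm (s - p) \<le> K * \<rho> ^ 3; norm (s - d) \<le> K * \<rho>\<^sup>2; norm s \<le> K * \<rho>; norm d \<le> K * \<rho>; \<rho> \<ge> 0\<rbrakk>
       \<Longrightarrow> \<bar>\<Lambda>1 s + C1 s s - (\<Lambda>1 p + C1 d d)\<bar> \<le> K' * \<rho> ^ 3"
      using quadratic_perturbation[OF \<Lambda>1 C1, of K] K by auto
    \<comment> \<open>\<open>\<eta>\<close> absorbs the cubic error of the exponential. As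
      \<open>norm v\<close> is at most \<open>KI * norm (Z v)\<close>, it uses up at most half of
      the negativity in \<open>levi\<close>.\<close>
    define \<eta> where "\<eta> = \<epsilon> / (4 * KI\<^sup>2)"
    have \<eta>: "\<eta> > 0" using pm(1) KI(1) by (simp add: \<eta>_def)
    \<comment> \<open>The first term comes from v^2/2 in the expansion of exp v.\<close>
    define Q where "Q v w = 1 / 2 * \<Lambda>1 (vec_prod v w) + C1 v w + \<eta> * (v \<bullet> w)" for v w
    \<comment> \<open>The bounds ensure, in turn, the exponential estimate, that \<open>Z e\<close>
      stays where \<open>touch\<close> applies, and that the cubic error is at most \<eta>
      |v|^2.\<close>
    define \<delta> where "\<delta> = min 1 (min (min \<delta>1 \<delta>2 / (KZ * K)) (\<eta> / (K' + 1)))"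
    have \<delta>: "\<delta> > 0" using \<delta>1(1) \<delta>2(1) KZ(1) K \<eta> K'(1) by (simp add: \<delta>_def)
    have "vec.subspace (Z' ` L)"
      using L(1) unfolding vec.subspace_def
      by (auto simp: image_iff Z'_def) (metis scale_by_add scale_by_complex_linear vec.scale_zero_left)+
    moreover have "vec.dim (Z' ` L) = q + 1"
    proof -
      have "Vector_Spaces.linear (*s) (*s) Z'"
        by (simp add: Vector_Spaces.linear_iff vec.vector_space_axioms Z'_def scale_by_add scale_by_complex_linear)
      moreover have "inj_on Z' (vec.span L)" by (metis ZZ'(1) inj_onI)
      ultimately show ?thesis using vec.dim_image_eq L(2) by metis
    qed
    ultimately have "\<not> real_q_convex_on q V u"
    proof (rule not_convex_if_touching[where u = u and \<Lambda> = \<Lambda>1 and Q = Q, OF V x0 q pm(3)[folded x0_def] _ _ \<Lambda>1 _ \<delta>])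
      show "bilinear Q"
        unfolding bilinear_def Q_def
        by (intro conjI allI linearI) (simp_all add: linear_add[OF \<Lambda>1] linear_scale[OF \<Lambda>1]
            bilinear_ladd[OF C1] bilinear_radd[OF C1] bilinear_lmul[OF C1] bilinear_rmul[OF C1]
            vec_prod_bilinear inner_add_left inner_add_right algebra_simps)
    next
      fix v assume "v \<in> Z' ` L" and v: "v \<noteq> 0"
      then have vL: "Z v \<in> L" using ZZ'(1) by auto
      have i: "Z (\<i> *s v) = \<i> *s Z v"
        unfolding Z_def by (rule scale_by_complex_linear)
      have "(\<i> *s v) \<bullet> (\<i> *s v) = v \<bullet> v" using norm_ii_scale[of v] by (simp add: norm_eq)
      then have "Q v v + Q (\<i> *s v) (\<i> *s v) = C1 v v + C1 (\<i> *s v) (\<i> *s v) + 2 * \<eta> * (norm v)\<^sup>2"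
        by (simp add: Q_def vec_prod_ii linear_neg[OF \<Lambda>1] power2_norm_eq_inner)
      also have "\<dots> = - \<epsilon> * (norm (Z v))\<^sup>2 + 2 * \<eta> * (norm v)\<^sup>2"
        using levi[OF vL] unfolding C1_def i by simp
      also have "\<dots> < 0"
      proof -
        have "Z v \<noteq> 0" using v ZZ'(2)[of v] ZZ'(2)[of 0] linear_0[OF Z] by metis
        then have pos: "(norm (Z v))\<^sup>2 > 0" by simp
        have "norm v \<le> KI * norm (Z v)" using KI(2)[of "Z v"] ZZ'(2)[of v] by simp
        then have "(norm v)\<^sup>2 \<le> (KI * norm (Z v))\<^sup>2" by (intro power_mono) auto
        then have "2 * \<eta> * (norm v)\<^sup>2 \<le> 2 * \<eta> * (KI * norm (Z v))\<^sup>2"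
          using \<eta> by (intro mult_left_mono) auto
        also have "\<dots> = \<epsilon> / 2 * (norm (Z v))\<^sup>2"
          using KI(1) by (simp add: \<eta>_def power_mult_distrib)
        also have "\<dots> < \<epsilon> * (norm (Z v))\<^sup>2" using pos pm(1) by simp
        finally show ?thesis by simp
      qed
      finally show "Q v v + Q (\<i> *s v) (\<i> *s v) < 0" .
    next
      fix v :: "complex ^ 'n" assume v: "norm v < \<delta>"
      then have v1: "norm v \<le> 1" by (simp add: \<delta>_def)
      \<comment> \<open>The relative displacement belonging to z = z0 exp v, for which
        \<open>ln_abs z\<close> is exactly \<open>x0 + Re_vec v\<close>.\<close>
      define e :: "complex ^ 'n" where "e = (\<chi> i. exp (v $ i) - 1)"
      note es = exp_vec_estimate[OF v1, folded e_def K_def]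
      have "norm (Z e) < min \<delta>1 \<delta>2"
      proof -
        have "norm (Z e) \<le> KZ * (K * norm v)"
          using KZ(1) es(3) by (intro order_trans[OF KZ(2)] mult_left_mono) auto
        also have "\<dots> < KZ * (K * (min \<delta>1 \<delta>2 / (KZ * K)))"
          using v KZ(1) K by (intro mult_strict_left_mono) (auto simp: \<delta>_def)
        also have "\<dots> = min \<delta>1 \<delta>2" using KZ(1) K by simp
        finally show ?thesis .
      qed
      then have "u (ln_abs (z0 + Z e)) \<le> ereal (\<alpha> + \<Lambda>1 e + C1 e e)"
        using touch[of "Z e"] by (simp add: \<Lambda>1_def C1_def)
      moreover have "ln_abs (z0 + Z e) = x0 + Re_vec v"
      proof -
        have "ln (cmod ((z0 + Z e) $ i)) = ln (cmod (z0 $ i)) + Re (v $ i)" for i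
        proof -
          have "(z0 + Z e) $ i = z0 $ i * exp (v $ i)"
            by (simp add: Z_def scale_by_def e_def algebra_simps)
          then show ?thesis using nz[of i] by (simp add: norm_mult ln_mult)
        qed
        then show ?thesis by (simp add: x0_def ln_abs_def Re_vec_def vec_eq_iff)
      qed
      moreover have "\<alpha> + \<Lambda>1 e + C1 e e \<le> \<alpha> + \<Lambda>1 v + Q v v"
      proof -
        have "\<bar>\<Lambda>1 e + C1 e e - (\<Lambda>1 (v + (1 / 2) *\<^sub>R vec_prod v v) + C1 v v)\<bar> \<le> K' * norm v ^ 3"
          by (rule K'(2)[OF es norm_ge_zero])
        moreover have "\<Lambda>1 (v + (1 / 2) *\<^sub>R vec_prod v v) = \<Lambda>1 v + 1 / 2 * \<Lambda>1 (vec_prod v v)"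
          by (simp add: linear_add[OF \<Lambda>1] linear_scale[OF \<Lambda>1])
        moreover have "K' * norm v ^ 3 \<le> \<eta> * (v \<bullet> v)"
        proof -
          have "(K' + 1) * norm v \<le> (K' + 1) * (\<eta> / (K' + 1))"
            using v K'(1) by (intro mult_left_mono) (auto simp: \<delta>_def)
          also have "\<dots> = \<eta>" using K'(1) by simp
          finally have "K' * norm v \<le> \<eta>" using norm_ge_zero[of v] unfolding distrib_right by linarith
          from mult_right_mono[OF this, of "(norm v)\<^sup>2"] show ?thesis
            unfolding power2_norm_eq_inner[symmetric] by (simp add: power2_eq_square power3_eq_cube mult.assoc)
        qed
        ultimately show ?thesis unfolding Q_def by (simp add: abs_le_iff)
      qed
      ultimately show "u (x0 + Re_vec v) \<le> ereal (\<alpha> + \<Lambda>1 v + Q v v)"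
        by (metis ereal_less_eq(3) order_trans)
    qed
    with cvx show False by blast
  qed
qed

theorem corollary4p9:
  fixes q :: nat and V :: "(real ^ 'n) set" and u :: "real ^ 'n \<Rightarrow> ereal"
  assumes "open V"
    and "\<And>x. x \<in> V \<Longrightarrow> u x \<noteq> \<infinity>"
  shows "real_q_convex_on q V u \<longleftrightarrow> q_plurisubharmonic_on q (Omega V) (\<lambda>z. u (ln_abs z))"
  using plurisubharmonic_if_real_q_convex real_q_convex_if_plurisubharmonic assms(1) by blast

end
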